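(* Let $H$ be an infinite-dimensional Hilbert space. There exists a positive sesquilinear jointly completely bounded form on $\mathcal B(H)$ which cannot be majorized by an integral form. More precisely, there is a constant $C>0$ such that for every $n\in\mathbb N$ there exists a positive, integral, sesquilinear form $B$ on $\mathcal B(H)$ of rank $n$ such that $$(1+\ln n)\,\|B\|_{jcb}\le C\,\|\tilde B\|_I$$ holds for all integral forms $\tilde B$ satisfying $B\le\tilde B$.
   Context: For a $C^*$-algebra $A$, $\bar A$ is the complex conjugate $C^*$-algebra; sesquilinear forms on $A$ (antilinear in the first variable) are identified with bilinear forms $\bar A\times A\to\mathbb C$. A sesquilinear form $B$ is positive if $B(x,x)\ge 0$ for all $x$; its rank is $\dim A/L$ with $L=\{x: B(x,x)=0\}$. A bilinear form $B:A_1\times A_2\to\mathbb C$ on $C^*$-algebras is integral if there is $C>0$ with $|\sum_k B(x_k,y_k)|\le C\|\sum_k x_k\otimes y_k\|_{A_1\otimes_{\min}A_2}$ for all finite sequences; $\|B\|_I$ is the least such $C$. (For forms on $A$, take $A_1=\bar A$, $A_2=A$.) $B$ is jointly completely bounded (jcb) if there is $C$ with $\|\sum_{k,j}B(a_k,b_j)\,x_k\otimes y_j\|_{M_m\otimes_{\min}M_m}\le C\|\sum_k a_k\otimes x_k\|_{M_m(A_1)}\|\sum_j b_j\otimes y_j\|_{M_m(A_2)}$ for all $m$ and all finite sequences $(a_k)\subset A_1$, $(b_j)\subset A_2$, $(x_k),(y_j)\subset M_m$; $\|B\|_{jcb}$ is the least such $C$. A positive sesquilinear form $B$ is majorized by a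 form $\tilde B$, written $B\le\tilde B$, if $B(x,x)\le|\tilde B(x,x)|$ for all $x$. *)

theory Defs
  imports "HOL-Analysis.Analysis"
begin

section \<open>Complex Hilbert spaces\<close>

class complex_vector = ab_group_add +
  fixes scaleC :: "complex \<Rightarrow> 'a \<Rightarrow> 'a"  (infixr "*\<^sub>C" 75)
  assumes scaleC_add_right: "c *\<^sub>C (x + y) = c *\<^sub>C x + c *\<^sub>C y"
    and scaleC_add_left: "(c + d) *\<^sub>C x = c *\<^sub>C x + d *\<^sub>C x"
    and scaleC_scaleC: "c *\<^sub>C d *\<^sub>C x = (c * d) *\<^sub>C x"
    and scaleC_one: "1 *\<^sub>C x = x"

interpretation complex_vector: vector_space "scaleC :: complex \<Rightarrow> 'a \<Rightarrow> 'a::complex_vector"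
  by unfold_locales (simp_all add: scaleC_add_right scaleC_add_left scaleC_scaleC scaleC_one)

text \<open>The inner product is antilinear in the first variable.\<close>

class complex_hilbert_space = banach + complex_vector +
  fixes cinner :: "'a \<Rightarrow> 'a \<Rightarrow> complex"
  assumes scaleR_scaleC: "r *\<^sub>R x = complex_of_real r *\<^sub>C x"
    and cinner_commute: "cinner x y = cnj (cinner y x)"
    and cinner_add_right: "cinner x (y + z) = cinner x y + cinner x z"
    and cinner_scaleC_right: "cinner x (c *\<^sub>C y) = c * cinner x y"
    and cinner_norm: "cinner x x = complex_of_real ((norm x)\<^sup>2)"

text \<open>The conjugate Hilbert space: the same additive group, with conjugated scalar
  multiplication and inner product.\<close>

typedef 'a conjugate = "UNIV :: 'a set"
  morphisms from_conj to_conj ..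

setup_lifting type_definition_conjugate

instantiation conjugate :: (complex_hilbert_space) real_normed_vector
begin

lift_definition zero_conjugate :: "'a conjugate" is 0 .
lift_definition plus_conjugate :: "'a conjugate \<Rightarrow> 'a conjugate \<Rightarrow> 'a conjugate" is "(+)" .
lift_definition minus_conjugate :: "'a conjugate \<Rightarrow> 'a conjugate \<Rightarrow> 'a conjugate" is "(-)" .
lift_definition uminus_conjugate :: "'a conjugate \<Rightarrow> 'a conjugate" is uminus .
lift_definition scaleR_conjugate :: "real \<Rightarrow> 'a conjugate \<Rightarrow> 'a conjugate" is "(*\<^sub>R)" .
lift_definition norm_conjugate :: "'a conjugate \<Rightarrow> real" is norm .
lift_definition sgn_conjugate :: "'a conjugate \<Rightarrow> 'a conjugate" is sgn .
lift_definition dist_conjugate :: "'a conjugate \<Rightarrow> 'a conjugate \<Rightarrow> real" is dist .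

definition uniformity_conjugate :: "('a conjugate \<times> 'a conjugate) filter" where
  "uniformity_conjugate = (INF e\<in>{0 <..}. principal {(x, y). dist x y < e})"

definition open_conjugate :: "'a conjugate set \<Rightarrow> bool" where
  "open_conjugate U \<longleftrightarrow> (\<forall>x\<in>U. eventually (\<lambda>(x', y). x' = x \<longrightarrow> y \<in> U) uniformity)"

instance
proof
  fix x y z :: "'a conjugate" and r s :: real
  show "x + y + z = x + (y + z)" by transfer (simp add: add.assoc)
  show "x + y = y + x" by transfer (simp add: add.commute)
  show "0 + x = x" by transfer simp
  show "- x + x = 0" by transfer simp
  show "x - y = x + - y" by transfer simp
  show "r *\<^sub>R (x + y) = r *\<^sub>R x + r *\<^sub>R y" by transfer (simp add: scaleR_add_right)
  show "(r + s) *\<^sub>R x = r *\<^sub>R x + s *\<^sub>R x" by transfer (simp add: scaleR_add_left)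
  show "r *\<^sub>R s *\<^sub>R x = (r * s) *\<^sub>R x" by transfer simp
  show "1 *\<^sub>R x = x" by transfer simp
  show "dist x y = norm (x - y)" by transfer (simp add: dist_norm)
  show "sgn x = inverse (norm x) *\<^sub>R x" by transfer (simp add: sgn_div_norm)
  show "norm x = 0 \<longleftrightarrow> x = 0" by transfer simp
  show "norm (x + y) \<le> norm x + norm y" by transfer (rule norm_triangle_ineq)
  show "norm (r *\<^sub>R x) = \<bar>r\<bar> * norm x" by transfer simp
qed (rule uniformity_conjugate_def open_conjugate_def)+

end

instantiation conjugate :: (complex_hilbert_space) complex_hilbert_space
begin

lift_definition scaleC_conjugate :: "complex \<Rightarrow> 'a conjugate \<Rightarrow> 'a conjugate"
  is "\<lambda>c x. cnj c *\<^sub>C x" .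
lift_definition cinner_conjugate :: "'a conjugate \<Rightarrow> 'a conjugate \<Rightarrow> complex"
  is "\<lambda>x y. cnj (cinner x y)" .

instance
proof
  fix x y z :: "'a conjugate" and r :: real and c d :: complex
  show "c *\<^sub>C (x + y) = c *\<^sub>C x + c *\<^sub>C y" by transfer (simp add: scaleC_add_right)
  show "(c + d) *\<^sub>C x = c *\<^sub>C x + d *\<^sub>C x" by transfer (simp add: scaleC_add_left)
  show "c *\<^sub>C d *\<^sub>C x = (c * d) *\<^sub>C x" by transfer (simp add: scaleC_scaleC)
  show "1 *\<^sub>C x = x" by transfer (simp add: scaleC_one)
  show "r *\<^sub>R x = complex_of_real r *\<^sub>C x" by transfer (simp add: scaleR_scaleC)
  show "cinner x y = cnj (cinner y x)" by transfer (subst cinner_commute, simp)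
  show "cinner x (y + z) = cinner x y + cinner x z" by transfer (simp add: cinner_add_right)
  show "cinner x (c *\<^sub>C y) = c * cinner x y" by transfer (simp add: cinner_scaleC_right)
  show "cinner x x = complex_of_real ((norm x)\<^sup>2)" by transfer (simp add: cinner_norm)
next
  fix X :: "nat \<Rightarrow> 'a conjugate"
  have dist_conj: "dist x y = dist (from_conj x) (from_conj y)" for x y :: "'a conjugate"
    by transfer simp
  assume "Cauchy X"
  then have "Cauchy (\<lambda>n. from_conj (X n))"
    by (simp add: Cauchy_def dist_conj)
  then obtain l where "(\<lambda>n. from_conj (X n)) \<longlonglongrightarrow> l"
    using Cauchy_convergent convergent_def by blast
  then have "X \<longlonglongrightarrow> to_conj l"
    by (simp add: lim_sequentially dist_conj to_conj_inverse)
  then show "convergent X"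
    by (auto simp: convergent_def)
qed

end

section \<open>The algebra of bounded operators\<close>

typedef (overloaded) 'a bop =
  "{f :: 'a::complex_hilbert_space \<Rightarrow> 'a. bounded_linear f \<and> (\<forall>c x. f (c *\<^sub>C x) = c *\<^sub>C f x)}"
  morphisms bop_apply Bop
  by (rule exI[of _ "\<lambda>x. x"]) (simp add: bounded_linear_ident)

setup_lifting type_definition_bop

lemma bounded_linear_scaleC: "bounded_linear (\<lambda>x :: 'a::complex_hilbert_space. c *\<^sub>C x)"
proof (rule bounded_linear_intro[where K = "cmod c"])
  fix x y :: 'a and r :: real
  show "c *\<^sub>C (x + y) = c *\<^sub>C x + c *\<^sub>C y" by (rule scaleC_add_right)
  show "c *\<^sub>C r *\<^sub>R x = r *\<^sub>R c *\<^sub>C x"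
    by (simp add: scaleR_scaleC scaleC_scaleC mult.commute)
  have "complex_of_real ((norm (c *\<^sub>C x))\<^sup>2) = c * cnj (c * cinner x x)"
    by (metis cinner_norm cinner_scaleC_right cinner_commute)
  also have "\<dots> = complex_of_real ((norm x * cmod c)\<^sup>2)"
    using complex_norm_square[of c] by (simp add: cinner_norm power_mult_distrib)
  finally have "(norm (c *\<^sub>C x))\<^sup>2 = (norm x * cmod c)\<^sup>2"
    by (simp only: of_real_eq_iff)
  then show "norm (c *\<^sub>C x) \<le> norm x * cmod c"
    by (simp add: power2_eq_iff_nonneg)
qed

instantiation bop :: (complex_hilbert_space) complex_vector
begin

lift_definition zero_bop :: "'a bop" is "\<lambda>x. 0"
  by simp
lift_definition plus_bop :: "'a bop \<Rightarrow> 'a bop \<Rightarrow> 'a bop" is "\<lambda>f g x. f x + g x"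
  by (auto simp: bounded_linear_add scaleC_add_right)
lift_definition uminus_bop :: "'a bop \<Rightarrow> 'a bop" is "\<lambda>f x. - f x"
  by (auto simp: bounded_linear_minus)
lift_definition minus_bop :: "'a bop \<Rightarrow> 'a bop \<Rightarrow> 'a bop" is "\<lambda>f g x. f x - g x"
  by (auto simp: bounded_linear_sub complex_vector.scale_right_diff_distrib)
lift_definition scaleC_bop :: "complex \<Rightarrow> 'a bop \<Rightarrow> 'a bop" is "\<lambda>c f x. c *\<^sub>C f x"
  by (auto simp: scaleC_scaleC mult.commute
      intro: bounded_linear_compose[OF bounded_linear_scaleC])

instance
  by standard
    (transfer; auto simp: fun_eq_iff scaleC_add_right scaleC_add_left scaleC_scaleC scaleC_one)+

end

lemma bounded_linear_to_conj:
  "bounded_linear (to_conj :: 'a::complex_hilbert_space \<Rightarrow> 'a conjugate)"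
  by (rule bounded_linear_intro[where K = 1])
    (auto simp: plus_conjugate_def scaleR_conjugate_def norm_conjugate_def to_conj_inverse)

lemma bounded_linear_from_conj:
  "bounded_linear (from_conj :: 'a::complex_hilbert_space conjugate \<Rightarrow> 'a)"
  by (rule bounded_linear_intro[where K = 1])
    (auto simp: plus_conjugate.rep_eq scaleR_conjugate.rep_eq norm_conjugate.rep_eq)

text \<open>The conjugate algebra of \<open>B(H)\<close> is realized as \<open>B(conjugate H)\<close>: the same operators,
  regarded as acting on the conjugate space. The identity map \<open>B(H) \<rightarrow> B(conjugate H)\<close> is
  antilinear, multiplicative and adjoint-preserving.\<close>

lift_definition conj_op :: "'a::complex_hilbert_space bop \<Rightarrow> 'a conjugate bop"
  is "\<lambda>f x. to_conj (f (from_conj x))"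
  by (auto simp: scaleC_conjugate_def to_conj_inverse
      intro!: bounded_linear_compose[OF bounded_linear_to_conj]
        bounded_linear_compose[OF _ bounded_linear_from_conj])

lift_definition unconj_op :: "'a::complex_hilbert_space conjugate bop \<Rightarrow> 'a bop"
  is "\<lambda>f x. from_conj (f (to_conj x))"
proof -
  fix f :: "'a conjugate \<Rightarrow> 'a conjugate"
  assume f: "bounded_linear f \<and> (\<forall>c x. f (c *\<^sub>C x) = c *\<^sub>C f x)"
  have "to_conj (c *\<^sub>C x) = cnj c *\<^sub>C to_conj x" for c and x :: 'a
    by (simp add: scaleC_conjugate_def to_conj_inverse)
  with f show "bounded_linear (\<lambda>x. from_conj (f (to_conj x))) \<and>
      (\<forall>c x. from_conj (f (to_conj (c *\<^sub>C x))) = c *\<^sub>C from_conj (f (to_conj x)))"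
    by (auto simp: scaleC_conjugate.rep_eq
        intro!: bounded_linear_compose[OF bounded_linear_from_conj]
          bounded_linear_compose[OF _ bounded_linear_to_conj])
qed

lemma unconj_conj_op [simp]: "unconj_op (conj_op x) = x"
  by transfer (simp add: to_conj_inverse)

lemma conj_unconj_op [simp]: "conj_op (unconj_op x) = x"
  by transfer (simp add: from_conj_inverse)

lemma conj_op_scaleC: "conj_op (c *\<^sub>C x) = cnj c *\<^sub>C conj_op x"
  by transfer (simp add: scaleC_conjugate_def to_conj_inverse)

lemma conj_op_add: "conj_op (x + y) = conj_op x + conj_op y"
  by transfer (simp add: plus_conjugate_def to_conj_inverse)

section \<open>Forms\<close>

definition bilinear_form :: "('a::complex_vector \<Rightarrow> 'b::complex_vector \<Rightarrow> complex) \<Rightarrow> bool" where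
  "bilinear_form B \<longleftrightarrow>
     (\<forall>x. Vector_Spaces.linear (*\<^sub>C) (*) (B x)) \<and>
     (\<forall>y. Vector_Spaces.linear (*\<^sub>C) (*) (\<lambda>x. B x y))"

definition sesquilinear_form :: "('a::complex_vector \<Rightarrow> 'a \<Rightarrow> complex) \<Rightarrow> bool" where
  "sesquilinear_form B \<longleftrightarrow>
     (\<forall>x. Vector_Spaces.linear (*\<^sub>C) (*) (B x)) \<and>
     (\<forall>x x' y. B (x + x') y = B x y + B x' y) \<and>
     (\<forall>c x y. B (c *\<^sub>C x) y = cnj c * B x y)"

definition bilinear_of ::
  "('h::complex_hilbert_space bop \<Rightarrow> 'h bop \<Rightarrow> complex) \<Rightarrow> 'h conjugate bop \<Rightarrow> 'h bop \<Rightarrow> complex"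
  where "bilinear_of B = (\<lambda>x y. B (unconj_op x) y)"

lemma bilinear_form_bilinear_of: "bilinear_form (bilinear_of B) \<longleftrightarrow> sesquilinear_form B"
proof -
  have surj: "(\<forall>x. P (unconj_op x)) \<longleftrightarrow> (\<forall>x. P x)" for P :: "'a bop \<Rightarrow> bool"
    by (metis unconj_conj_op)
  have scale: "unconj_op (c *\<^sub>C x) = cnj c *\<^sub>C unconj_op x" for c and x :: "'a conjugate bop"
    by (metis complex_cnj_cnj conj_op_scaleC conj_unconj_op unconj_conj_op)
  have add: "unconj_op (x + y) = unconj_op x + unconj_op y" for x y :: "'a conjugate bop"
    by (metis conj_op_add conj_unconj_op unconj_conj_op)
  have lin: "Vector_Spaces.linear (*\<^sub>C) (*) f \<longleftrightarrow>
      (\<forall>x y. f (x + y) = f x + f y) \<and> (\<forall>c x. f (c *\<^sub>C x) = c * f x)"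
    for f :: "'b::complex_vector \<Rightarrow> complex"
    using complex_vector.vector_space_axioms[where 'a = 'b]
    by (auto simp: Vector_Spaces.linear_iff vector_space_def module_def algebra_simps)
  have "(\<forall>y. Vector_Spaces.linear (*\<^sub>C) (*) (\<lambda>x. B (unconj_op x) y)) \<longleftrightarrow>
      (\<forall>x x' y. B (x + x') y = B x y + B x' y) \<and> (\<forall>c x y. B (c *\<^sub>C x) y = cnj c * B x y)"
    unfolding lin add scale by (metis complex_cnj_cnj unconj_conj_op)
  moreover have "(\<forall>x. Vector_Spaces.linear (*\<^sub>C) (*) (B (unconj_op x))) \<longleftrightarrow>
      (\<forall>x. Vector_Spaces.linear (*\<^sub>C) (*) (B x))"
    by (rule surj)
  ultimately show ?thesis
    by (simp add: bilinear_form_def sesquilinear_form_def bilinear_of_def)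
qed

definition positive_form :: "('a \<Rightarrow> 'a \<Rightarrow> complex) \<Rightarrow> bool" where
  "positive_form B \<longleftrightarrow> (\<forall>x. B x x \<in> \<real> \<and> 0 \<le> Re (B x x))"

text \<open>\<open>B(x,x)\<close> is real for the positive forms \<open>B\<close> to which this is applied.\<close>

definition majorized_by :: "('a \<Rightarrow> 'a \<Rightarrow> complex) \<Rightarrow> ('a \<Rightarrow> 'a \<Rightarrow> complex) \<Rightarrow> bool" where
  "majorized_by B B' \<longleftrightarrow> (\<forall>x. Re (B x x) \<le> cmod (B' x x))"

text \<open>\<open>quotient_dim L n\<close>: the quotient by the subspace \<open>L\<close> has dimension \<open>n\<close>, i.e. the
  classes of the elements of some \<open>n\<close>-element set \<open>E\<close> form a basis of it.\<close>

definition quotient_dim :: "'a::complex_vector set \<Rightarrow> nat \<Rightarrow> bool" where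
  "quotient_dim L n \<longleftrightarrow> (\<exists>E. finite E \<and> card E = n \<and>
     (\<forall>c. (\<Sum>e\<in>E. c e *\<^sub>C e) \<in> L \<longrightarrow> (\<forall>e\<in>E. c e = 0)) \<and>
     (\<forall>x. \<exists>c. x - (\<Sum>e\<in>E. c e *\<^sub>C e) \<in> L))"

definition form_rank :: "('a::complex_vector \<Rightarrow> 'a \<Rightarrow> complex) \<Rightarrow> nat \<Rightarrow> bool" where
  "form_rank B n \<longleftrightarrow> quotient_dim {x. B x x = 0} n"

section \<open>Integral forms\<close>

text \<open>A list of pairs \<open>(u\<^sub>i, v\<^sub>i)\<close> represents \<open>\<Sum>\<^sub>i u\<^sub>i \<otimes> v\<^sub>i\<close> in an algebraic tensor product.
  \<open>hilbert_tensor_norm\<close> is the norm of the Hilbert space tensor product, in which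
  \<open>\<langle>u \<otimes> v, u' \<otimes> v'\<rangle> = \<langle>u, u'\<rangle> \<langle>v, v'\<rangle>\<close>, and \<open>min_tensor_norm\<close> is the norm of
  \<open>\<Sum>\<^sub>k x\<^sub>k \<otimes> y\<^sub>k\<close> as an operator on that tensor product.\<close>

definition hilbert_tensor_norm ::
  "('h::complex_hilbert_space \<times> 'k::complex_hilbert_space) list \<Rightarrow> real" where
  "hilbert_tensor_norm us =
     sqrt (Re (\<Sum>(u, v)\<leftarrow>us. \<Sum>(u', v')\<leftarrow>us. cinner u u' * cinner v v'))"

definition tensor_apply ::
  "('h::complex_hilbert_space bop \<times> 'k::complex_hilbert_space bop) list \<Rightarrow> ('h \<times> 'k) list \<Rightarrow> ('h \<times> 'k) list"
  where "tensor_apply ts us = [(bop_apply x u, bop_apply y v). (x, y) \<leftarrow> ts, (u, v) \<leftarrow> us]"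

definition min_tensor_norm ::
  "('h::complex_hilbert_space bop \<times> 'k::complex_hilbert_space bop) list \<Rightarrow> real" where
  "min_tensor_norm ts = Inf {c. 0 \<le> c \<and>
     (\<forall>us. hilbert_tensor_norm (tensor_apply ts us) \<le> c * hilbert_tensor_norm us)}"

definition integral_bounds ::
  "('h::complex_hilbert_space bop \<Rightarrow> 'k::complex_hilbert_space bop \<Rightarrow> complex) \<Rightarrow> real set" where
  "integral_bounds B = {C. 0 < C \<and>
     (\<forall>ts. cmod (\<Sum>(x, y)\<leftarrow>ts. B x y) \<le> C * min_tensor_norm ts)}"

definition integral_form ::
  "('h::complex_hilbert_space bop \<Rightarrow> 'k::complex_hilbert_space bop \<Rightarrow> complex) \<Rightarrow> bool" where
  "integral_form B \<longleftrightarrow> bilinear_form B \<and> integral_bounds B \<noteq> {}"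

definition integral_norm ::
  "('h::complex_hilbert_space bop \<Rightarrow> 'k::complex_hilbert_space bop \<Rightarrow> complex) \<Rightarrow> real" where
  "integral_norm B = Inf (integral_bounds B)"

section \<open>Jointly completely bounded forms\<close>

text \<open>Norm of the operator on the Hilbert space direct sum of copies of \<open>'v\<close> indexed by \<open>I\<close>
  whose matrix entries are the operators \<open>T i j\<close>.\<close>

definition block_norm :: "'i set \<Rightarrow> ('i \<Rightarrow> 'i \<Rightarrow> 'v \<Rightarrow> 'v::real_normed_vector) \<Rightarrow> real" where
  "block_norm I T = Inf {c. 0 \<le> c \<and>
     (\<forall>\<xi>. L2_set (\<lambda>i. norm (\<Sum>j\<in>I. T i j (\<xi> j))) I \<le> c * L2_set (\<lambda>j. norm (\<xi> j)) I)}"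

text \<open>Elements of \<open>M\<^sub>m\<close> are functions \<open>nat \<Rightarrow> nat \<Rightarrow> complex\<close>, of which only the values at
  arguments below \<open>m\<close> matter. A list of pairs \<open>(a\<^sub>k, x\<^sub>k)\<close> represents \<open>\<Sum>\<^sub>k a\<^sub>k \<otimes> x\<^sub>k\<close>, which
  is the matrix with entries \<open>\<Sum>\<^sub>k x\<^sub>k(i,j) a\<^sub>k\<close> in \<open>M\<^sub>m(B(H))\<close>.\<close>

definition matrix_alg_norm ::
  "nat \<Rightarrow> ('h::complex_hilbert_space bop \<times> (nat \<Rightarrow> nat \<Rightarrow> complex)) list \<Rightarrow> real" where
  "matrix_alg_norm m as = block_norm {..<m} (\<lambda>i j. bop_apply (\<Sum>(a, x)\<leftarrow>as. x i j *\<^sub>C a))"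

text \<open>\<open>M\<^sub>m \<otimes>\<^sub>m\<^sub>i\<^sub>n M\<^sub>m\<close> acts on the space with orthonormal basis indexed by pairs; \<open>x \<otimes> y\<close> is the
  Kronecker product.\<close>

definition kronecker_norm ::
  "nat \<Rightarrow> (complex \<times> (nat \<Rightarrow> nat \<Rightarrow> complex) \<times> (nat \<Rightarrow> nat \<Rightarrow> complex)) list \<Rightarrow> real" where
  "kronecker_norm m ts = block_norm ({..<m} \<times> {..<m})
     (\<lambda>(i, i') (j, j') z. (\<Sum>(b, x, y)\<leftarrow>ts. b * (x i j * y i' j')) * z)"

definition jcb_bounds ::
  "('h::complex_hilbert_space bop \<Rightarrow> 'k::complex_hilbert_space bop \<Rightarrow> complex) \<Rightarrow> real set" where
  "jcb_bounds B = {C. 0 \<le> C \<and> (\<forall>m as bs.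
     kronecker_norm m [(B a b, x, y). (a, x) \<leftarrow> as, (b, y) \<leftarrow> bs]
       \<le> C * matrix_alg_norm m as * matrix_alg_norm m bs)}"

definition jcb_form ::
  "('h::complex_hilbert_space bop \<Rightarrow> 'k::complex_hilbert_space bop \<Rightarrow> complex) \<Rightarrow> bool" where
  "jcb_form B \<longleftrightarrow> bilinear_form B \<and> jcb_bounds B \<noteq> {}"

definition jcb_norm ::
  "('h::complex_hilbert_space bop \<Rightarrow> 'k::complex_hilbert_space bop \<Rightarrow> complex) \<Rightarrow> real" where
  "jcb_norm B = Inf (jcb_bounds B)"

end

(* Fix L with 4^L <= n and place the numbers i < n, for every level j <= L, as matrix units at position
   (i mod 4^j, i div 4^j) of a block of its own.  Let x_i be the sum over j of these matrix units, phi_i(x) the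
   sum of the corresponding entries of x, and B(x, y) = sum_i cnj (phi_i x) * phi_i y, a form of rank n.

   The part of B that couples the levels k and l has jcb norm at most sqrt(2n) 2^(-|k-l|), since the blocks
   interpolate between a row and a column; hence the jcb norm of B is only O(sqrt n (L+1)).

   If B' majorizes B, the numerical range of B' relative to B misses the open unit disc and is convex
   (Toeplitz--Hausdorff), so it contains the average of the values at the x_i.  Hence
   |sum_i B'(x_i, x_i)| >= sum_i B(x_i, x_i) = n (L+1)^2, whereas the minimal tensor norm of
   sum_i conj(x_i) (x) x_i is at most sqrt(2n) by Schur's test.  The quotient of the two bounds grows like L+1,
   that is, like 1 + ln n.  A weighted series of such forms has no integral majorant at all. *)

theory Submission
  imports Defs
begin

section \<open>Complex inner products\<close>

text \<open>With one level alone, the upper bound for the jcb norm and the lower bound for majorants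
  are both of order \<open>sqrt n\<close>; the logarithm comes from the different ways in which
  levels add up. In the jcb norm the pairs of levels decay geometrically off the diagonal, so all
  pairs together cost a factor L+1 only. On the vectors x_i all pairs contribute coherently and give
  (L+1)^2. In the minimal tensor norm the pairs act between mutually orthogonal subspaces, so only
  the largest one counts. Powers of 4 appear because numbers of rows and columns enter the jcb bound
  through a square root: 4^k rows against at most 2n/4^l columns give sqrt(2n) 2^(k-l). Rows may be
  counted in either factor and columns in the other; counting rows at the lower level gives decay in
  |k-l|. A majorant B' need not be positive. Its values at the x_i are bounded below in modulus only
  and could cancel in the sum; convexity of the numerical range removes this obstacle.\<close>

lemma cinner_add_left: "cinner (x + y) z = cinner x z + cinner y (z :: 'a::complex_hilbert_space)"
  by (metis cinner_add_right cinner_commute complex_cnj_add)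

lemma cinner_scaleC_left: "cinner (c *\<^sub>C x) (y :: 'a::complex_hilbert_space) = cnj c * cinner x y"
  by (metis cinner_commute cinner_scaleC_right complex_cnj_mult)

lemma scaleC_zero_left [simp]: "0 *\<^sub>C x = (0 :: 'a::complex_vector)"
  by (rule complex_vector.scale_zero_left)

lemma scaleC_zero_right [simp]: "c *\<^sub>C (0 :: 'a::complex_vector) = 0"
  by (rule complex_vector.scale_zero_right)

lemma cinner_zero_right [simp]: "cinner (x :: 'a::complex_hilbert_space) 0 = 0"
  using cinner_scaleC_right[of x 0 0] by simp

lemma cinner_zero_left [simp]: "cinner 0 (x :: 'a::complex_hilbert_space) = 0"
  using cinner_scaleC_left[of 0 0 x] by simp

lemma cinner_diff_right: "cinner x (y - z) = cinner x y - cinner x (z :: 'a::complex_hilbert_space)"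
  using cinner_add_right[of x "y - z" z] by simp

lemma cinner_sum_right: "cinner (x :: 'a::complex_hilbert_space) (sum f A) = (\<Sum>a\<in>A. cinner x (f a))"
  by (induction A rule: infinite_finite_induct) (simp_all add: cinner_add_right)

lemma cinner_sum_left: "cinner (sum f A) (x :: 'a::complex_hilbert_space) = (\<Sum>a\<in>A. cinner (f a) x)"
  by (induction A rule: infinite_finite_induct) (simp_all add: cinner_add_left)

lemma cinner_sum_list_right:
  "cinner (x :: 'a::complex_hilbert_space) (sum_list (map f as)) = (\<Sum>a\<leftarrow>as. cinner x (f a))"
  by (induction as) (simp_all add: cinner_add_right)

lemma norm_scaleC: "norm (c *\<^sub>C x) = cmod c * norm (x :: 'a::complex_hilbert_space)"
proof -
  have "complex_of_real ((norm (c *\<^sub>C x))\<^sup>2) = cnj c * c * cinner x x"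
    by (simp only: cinner_norm[symmetric] cinner_scaleC_right cinner_scaleC_left mult_ac)
  also have "\<dots> = complex_of_real ((cmod c * norm x)\<^sup>2)"
    using complex_norm_square[of c] by (simp add: cinner_norm power_mult_distrib mult.commute)
  finally have "(norm (c *\<^sub>C x))\<^sup>2 = (cmod c * norm x)\<^sup>2"
    by (simp only: of_real_eq_iff)
  then show ?thesis
    by (simp add: power2_eq_iff_nonneg)
qed

section \<open>Orthonormal families, Bessel's inequality and the Gram-Schmidt process\<close>

definition orthonormal :: "('i \<Rightarrow> 'a::complex_hilbert_space) \<Rightarrow> 'i set \<Rightarrow> bool" where
  "orthonormal e I \<longleftrightarrow> (\<forall>i\<in>I. \<forall>j\<in>I. cinner (e i) (e j) = of_bool (i = j))"

lemma orthonormal_cinner: "orthonormal e I \<Longrightarrow> i \<in> I \<Longrightarrow> j \<in> I \<Longrightarrow> cinner (e i) (e j) = of_bool (i = j)"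
  by (simp add: orthonormal_def)

lemma orthonormal_norm:
  assumes "orthonormal e I" "i \<in> I"
  shows "norm (e i) = 1"
proof -
  have "complex_of_real ((norm (e i))\<^sup>2) = complex_of_real 1"
    using assms by (simp only: cinner_norm[symmetric]) (simp add: orthonormal_def)
  then have "(norm (e i))\<^sup>2 = 1"
    by (simp only: of_real_eq_iff)
  then show ?thesis
    using norm_ge_zero[of "e i"] by (auto simp: power2_eq_1_iff)
qed

lemma cinner_orthonormal_sum:
  assumes "orthonormal e I" "finite I" "i \<in> I"
  shows "cinner (e i) (\<Sum>j\<in>I. c j *\<^sub>C e j) = c i"
proof -
  have "cinner (e i) (\<Sum>j\<in>I. c j *\<^sub>C e j) = (\<Sum>j\<in>I. if j = i then c j else 0)"
    using assms by (auto simp: cinner_sum_right cinner_scaleC_right orthonormal_cinner intro!: sum.cong)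
  then show ?thesis
    using assms by simp
qed

lemma norm_orthonormal_sum:
  assumes "orthonormal e I" "finite I"
  shows "(norm (\<Sum>i\<in>I. c i *\<^sub>C e i))\<^sup>2 = (\<Sum>i\<in>I. (cmod (c i))\<^sup>2)"
proof -
  have "complex_of_real ((norm (\<Sum>i\<in>I. c i *\<^sub>C e i))\<^sup>2) = (\<Sum>i\<in>I. cnj (c i) * c i)"
    unfolding cinner_norm[symmetric] cinner_sum_left cinner_scaleC_left
    using assms by (intro sum.cong) (simp_all add: cinner_orthonormal_sum)
  also have "\<dots> = complex_of_real (\<Sum>i\<in>I. (cmod (c i))\<^sup>2)"
    by (simp add: complex_norm_square[unfolded of_real_power] mult.commute)
  finally show ?thesis
    by (simp only: of_real_eq_iff)
qed

lemma orthonormal_residual: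
  assumes "orthonormal e I" "finite I"
  shows "(norm (u - (\<Sum>i\<in>I. cinner (e i) u *\<^sub>C e i)))\<^sup>2 = (norm u)\<^sup>2 - (\<Sum>i\<in>I. (cmod (cinner (e i) u))\<^sup>2)"
proof -
  define v where "v = (\<Sum>i\<in>I. cinner (e i) u *\<^sub>C e i)"
  have orth: "cinner v (u - v) = 0"
    by (simp add: v_def cinner_sum_left cinner_scaleC_left cinner_diff_right cinner_orthonormal_sum[OF assms])
  then have orth': "cinner (u - v) v = 0"
    by (metis cinner_commute complex_cnj_zero)
  have "cinner u u = cinner (u - v + v) (u - v + v)"
    by simp
  also have "\<dots> = cinner (u - v) (u - v) + cinner v v"
    unfolding cinner_add_left cinner_add_right orth orth' by simp
  finally have "complex_of_real ((norm u)\<^sup>2) = complex_of_real ((norm (u - v))\<^sup>2 + (norm v)\<^sup>2)"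
    by (simp add: cinner_norm)
  then have "(norm u)\<^sup>2 = (norm (u - v))\<^sup>2 + (norm v)\<^sup>2"
    by (simp only: of_real_eq_iff)
  then show ?thesis
    using norm_orthonormal_sum[OF assms, of "\<lambda>i. cinner (e i) u"] by (simp add: v_def)
qed

lemma bessel:
  assumes "orthonormal e I" "finite I"
  shows "(\<Sum>i\<in>I. (cmod (cinner (e i) u))\<^sup>2) \<le> (norm u)\<^sup>2"
  using orthonormal_residual[OF assms, of u] zero_le_power2[of "norm (u - (\<Sum>i\<in>I. cinner (e i) u *\<^sub>C e i))"]
  by linarith

lemma cmod_cinner_unit: "norm e = 1 \<Longrightarrow> cmod (cinner e u) \<le> norm (u :: 'a::complex_hilbert_space)"
  using bessel[of "\<lambda>_. e" "{()}" u]
  by (simp add: orthonormal_def cinner_norm abs_le_square_iff[symmetric])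

text \<open>For finite orthonormal \<open>P\<close> this says that \<open>u\<close> lies in the span
  of \<open>P\<close>. Stating it through the coefficients makes Parseval immediate, and finite
  orthonormal sets take the place of a Hilbert basis in all tensor computations.\<close>

definition expands :: "'a::complex_hilbert_space set \<Rightarrow> 'a \<Rightarrow> bool" where
  "expands P u \<longleftrightarrow> u = (\<Sum>p\<in>P. cinner p u *\<^sub>C p)"

lemma parseval:
  assumes "finite P" "expands P u"
  shows "cinner u v = (\<Sum>p\<in>P. cnj (cinner p u) * cinner p v)"
proof -
  have "cinner u v = cinner (\<Sum>p\<in>P. cinner p u *\<^sub>C p) v"
    using assms by (simp add: expands_def)
  then show ?thesis
    by (simp add: cinner_sum_left cinner_scaleC_left)
qed

lemma expands_mono:
  assumes "expands P u" "P \<subseteq> Q" "finite Q" "orthonormal (\<lambda>x. x) Q"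
  shows "expands Q u"
proof -
  have "cinner q u = 0" if "q \<in> Q - P" for q
  proof -
    have "cinner q u = cinner q (\<Sum>p\<in>P. cinner p u *\<^sub>C p)"
      using assms by (simp add: expands_def)
    also have "\<dots> = 0"
      unfolding cinner_sum_right cinner_scaleC_right
      using assms that by (intro sum.neutral) (auto simp: orthonormal_def)
    finally show ?thesis .
  qed
  then have "(\<Sum>p\<in>Q. cinner p u *\<^sub>C p) = (\<Sum>p\<in>P. cinner p u *\<^sub>C p)"
    using assms by (intro sum.mono_neutral_right) auto
  then show ?thesis
    using assms by (simp add: expands_def)
qed

text \<open>One Gram-Schmidt step: the residual of \<open>u\<close> is nonzero exactly because the
  expansion fails, and its normalization is the new vector.\<close>

lemma orthonormal_extend:
  fixes u :: "'a::complex_hilbert_space"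
  assumes P: "orthonormal (\<lambda>x. x) P" "finite P" and u: "\<not> expands P u"
  obtains q where "q \<notin> P" "orthonormal (\<lambda>x. x) (insert q P)" "expands (insert q P) u"
proof -
  define r where "r = u - (\<Sum>p\<in>P. cinner p u *\<^sub>C p)"
  define N where "N = complex_of_real (norm r)"
  define q where "q = inverse N *\<^sub>C r"
  have r: "r \<noteq> 0"
    using u by (simp add: expands_def r_def)
  then have N: "N \<noteq> 0" "cnj N = N"
    by (simp_all add: N_def)
  have Nq: "N *\<^sub>C q = r"
    using N by (simp add: q_def scaleC_scaleC scaleC_one)
  have pr: "cinner p r = 0" if "p \<in> P" for p
    using that cinner_orthonormal_sum[OF P that, of "\<lambda>p. cinner p u"] by (simp add: r_def cinner_diff_right)
  have pq: "cinner p q = 0" if "p \<in> P" for p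
    using pr[OF that] by (simp add: q_def cinner_scaleC_right)
  have qp: "cinner q p = 0" if "p \<in> P" for p
    by (metis cinner_commute complex_cnj_zero pq that)
  have "norm q = 1"
    using r by (simp add: q_def norm_scaleC N_def norm_inverse)
  then have qq: "cinner q q = 1"
    by (simp add: cinner_norm)
  have notin: "q \<notin> P"
    using pq qq by force
  have on: "orthonormal (\<lambda>x. x) (insert q P)"
    using P pq qp qq notin by (auto simp: orthonormal_def)
  have u_eq: "u = N *\<^sub>C q + (\<Sum>p\<in>P. cinner p u *\<^sub>C p)"
    unfolding Nq by (simp add: r_def)
  have "cinner q u = cinner q (N *\<^sub>C q + (\<Sum>p\<in>P. cinner p u *\<^sub>C p))"
    using u_eq by simp
  also have "\<dots> = N"
    by (simp add: cinner_add_right cinner_sum_right cinner_scaleC_right qp qq)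
  finally have "expands (insert q P) u"
    unfolding expands_def using u_eq P notin by simp
  with notin on show thesis
    by (rule that)
qed

text \<open>Gram-Schmidt started from a prescribed \<open>P\<close>. Keeping \<open>P\<close> inside
  the result allows Bessel-type estimates against prescribed basis vectors.\<close>

lemma orthonormal_cover:
  fixes P :: "'a::complex_hilbert_space set"
  assumes "finite U" "orthonormal (\<lambda>x. x) P" "finite P"
  shows "\<exists>Q. P \<subseteq> Q \<and> finite Q \<and> orthonormal (\<lambda>x. x) Q \<and> (\<forall>u\<in>U. expands Q u)"
  using assms(1)
proof induction
  case empty
  then show ?case
    using assms by auto
next
  case (insert u U)
  then obtain Q where Q: "P \<subseteq> Q" "finite Q" "orthonormal (\<lambda>x. x) Q" "\<forall>u\<in>U. expands Q u"
    by auto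
  show ?case
  proof (cases "expands Q u")
    case True
    with Q show ?thesis
      by auto
  next
    case False
    then obtain q where q: "orthonormal (\<lambda>x. x) (Set.insert q Q)" "expands (Set.insert q Q) u"
      using orthonormal_extend Q by metis
    have "expands (Set.insert q Q) v" if "v \<in> U" for v
      using Q(4) Q(2) q(1) that by (intro expands_mono[of Q v "Set.insert q Q"]) blast+
    moreover have "P \<subseteq> Set.insert q Q"
      using Q(1) by blast
    ultimately show ?thesis
      using Q(2) q by (intro exI[of _ "Set.insert q Q"]) blast
  qed
qed

lemma orthonormal_image:
  assumes "orthonormal e I"
  shows "inj_on e I" "orthonormal (\<lambda>x. x) (e ` I)"
proof -
  have inj: "i = j" if "i \<in> I" "j \<in> I" "e i = e j" for i j
    using orthonormal_cinner[OF assms that(1,2)] orthonormal_cinner[OF assms that(1,1)] that(3)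
    by (cases "i = j") simp_all
  then show "inj_on e I"
    by (rule inj_onI)
  show "orthonormal (\<lambda>x. x) (e ` I)"
    unfolding orthonormal_def
  proof (intro ballI, elim imageE)
    fix p q i j assume "p = e i" "i \<in> I" "q = e j" "j \<in> I"
    then show "cinner p q = of_bool (p = q)"
      using orthonormal_cinner[OF assms, of i j] inj[of i j] by auto
  qed
qed

text \<open>Infinite dimension means that no finite orthonormal set spans, so Gram-Schmidt can
  always go on.\<close>

lemma orthonormal_family_exists:
  fixes I :: "'i set"
  assumes "\<not> (\<exists>E :: 'h::complex_hilbert_space set. finite E \<and> complex_vector.span E = UNIV)" "finite I"
  shows "\<exists>e :: 'i \<Rightarrow> 'h. orthonormal e I"
proof -
  have "\<exists>P :: 'h set. finite P \<and> card P = N \<and> orthonormal (\<lambda>x. x) P" for N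
  proof (induction N)
    case 0
    show ?case
      by (intro exI[of _ "{}"]) (simp add: orthonormal_def)
  next
    case (Suc N)
    then obtain P :: "'h set" where P: "finite P" "card P = N" "orthonormal (\<lambda>x. x) P"
      by auto
    obtain u where "u \<notin> complex_vector.span P"
      using assms(1) P(1) by auto
    moreover have "u \<in> complex_vector.span P" if "expands P u"
      using that unfolding expands_def
      by (metis (no_types, lifting) complex_vector.span_base complex_vector.span_scale complex_vector.span_sum)
    ultimately obtain q where "q \<notin> P" "orthonormal (\<lambda>x. x) (insert q P)"
      using orthonormal_extend[OF P(3,1)] by metis
    with P show ?case
      by (intro exI[of _ "insert q P"]) auto
  qed
  then obtain P :: "'h set" where P: "finite P" "card P = card I" "orthonormal (\<lambda>x. x) P"
    by blast
  then obtain e where "bij_betw e I P"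
    using assms(2) by (metis finite_same_card_bij)
  then have "orthonormal e I"
    using P by (auto simp: orthonormal_def bij_betw_def inj_on_def)
  then show ?thesis
    by blast
qed

section \<open>The Hilbert tensor norm\<close>

lemma sum_list_sum_swap:
  "(\<Sum>x\<leftarrow>xs. \<Sum>i\<in>I. f x i) = (\<Sum>i\<in>I. \<Sum>x\<leftarrow>xs. f x i :: 'a::comm_monoid_add)"
  by (induction xs) (simp_all add: sum.distrib)

lemma sum_list_product:
  "(\<Sum>x\<leftarrow>xs. f x) * (\<Sum>y\<leftarrow>ys. g y) = (\<Sum>x\<leftarrow>xs. \<Sum>y\<leftarrow>ys. f x * g y :: 'a::semiring_0)"
  by (induction xs) (simp_all add: distrib_right sum_list_const_mult)

text \<open>The inner product of \<open>p \<otimes> q\<close> with the represented tensor. It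
  depends on the tensor only, so different lists become comparable.\<close>

definition tensor_coeff ::
  "('h::complex_hilbert_space \<times> 'k::complex_hilbert_space) list \<Rightarrow> 'h \<Rightarrow> 'k \<Rightarrow> complex" where
  "tensor_coeff us p q = (\<Sum>(u, v)\<leftarrow>us. cinner p u * cinner q v)"

lemma cnj_sum_list: "cnj (sum_list (map f xs)) = (\<Sum>x\<leftarrow>xs. cnj (f x))"
  by (induction xs) simp_all

text \<open>Parseval in both factors turns the Gram sum of the definition into a sum of squares.
  Sign, triangle inequality and operator bounds are all read off from this form.\<close>

lemma hilbert_tensor_norm_eq:
  assumes P: "finite P" "\<And>u v. (u, v) \<in> set us \<Longrightarrow> expands P u"
    and Q: "finite Q" "\<And>u v. (u, v) \<in> set us \<Longrightarrow> expands Q v"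
  shows "hilbert_tensor_norm us = L2_set (\<lambda>(p, q). cmod (tensor_coeff us p q)) (P \<times> Q)"
proof -
  define f where "f p q = (\<lambda>(u, v). cinner p u * cinner q v)" for p :: 'a and q :: 'b
  have "(\<Sum>(u, v)\<leftarrow>us. \<Sum>(u', v')\<leftarrow>us. cinner u u' * cinner v v')
      = (\<Sum>w\<leftarrow>us. \<Sum>w'\<leftarrow>us. \<Sum>p\<in>P. \<Sum>q\<in>Q. cnj (f p q w) * f p q w')"
  proof (intro arg_cong[where f = sum_list] map_cong refl, clarify)
    fix u v assume uv: "(u, v) \<in> set us"
    have "(case w' of (u', v') \<Rightarrow> cinner u u' * cinner v v')
        = (\<Sum>p\<in>P. \<Sum>q\<in>Q. cnj (f p q (u, v)) * f p q w')" for w'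
      using P Q uv
      by (cases w') (simp add: f_def parseval[of P u] parseval[of Q v] sum_product mult_ac)
    then show "(\<Sum>(u', v')\<leftarrow>us. cinner u u' * cinner v v')
        = (\<Sum>w'\<leftarrow>us. \<Sum>p\<in>P. \<Sum>q\<in>Q. cnj (f p q (u, v)) * f p q w')"
      by (simp add: case_prod_unfold)
  qed
  also have "\<dots> = (\<Sum>p\<in>P. \<Sum>q\<in>Q. cnj (tensor_coeff us p q) * tensor_coeff us p q)"
    unfolding tensor_coeff_def f_def[symmetric] cnj_sum_list
    by (simp add: sum_list_sum_swap sum_list_mult_const sum_list_const_mult)
  also have "\<dots> = complex_of_real (\<Sum>p\<in>P. \<Sum>q\<in>Q. (cmod (tensor_coeff us p q))\<^sup>2)"
    by (simp add: complex_norm_square[unfolded of_real_power] mult.commute)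
  finally show ?thesis
    by (simp add: hilbert_tensor_norm_def L2_set_def sum.cartesian_product case_prod_unfold)
qed

lemma tensor_cover:
  fixes us :: "('h::complex_hilbert_space \<times> 'k::complex_hilbert_space) list"
  assumes "orthonormal (\<lambda>x. x) P0" "finite P0" "orthonormal (\<lambda>x. x) Q0" "finite Q0"
  obtains P Q where "P0 \<subseteq> P" "finite P" "orthonormal (\<lambda>x. x) P" "\<And>u v. (u, v) \<in> set us \<Longrightarrow> expands P u"
    "Q0 \<subseteq> Q" "finite Q" "orthonormal (\<lambda>x. x) Q" "\<And>u v. (u, v) \<in> set us \<Longrightarrow> expands Q v"
proof -
  obtain P where "P0 \<subseteq> P" "finite P" "orthonormal (\<lambda>x. x) P" "\<forall>u\<in>fst ` set us. expands P u"
    using orthonormal_cover[of "fst ` set us" P0] assms by blast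
  moreover obtain Q where "Q0 \<subseteq> Q" "finite Q" "orthonormal (\<lambda>x. x) Q" "\<forall>v\<in>snd ` set us. expands Q v"
    using orthonormal_cover[of "snd ` set us" Q0] assms by blast
  ultimately show thesis
    by (intro that[of P Q]) (blast | force)+
qed

lemma orthonormal_empty: "orthonormal e {}"
  by (simp add: orthonormal_def)

lemma tensor_cover_empty:
  fixes us :: "('h::complex_hilbert_space \<times> 'k::complex_hilbert_space) list"
  obtains P Q where "finite P" "orthonormal (\<lambda>x. x) P" "\<And>u v. (u, v) \<in> set us \<Longrightarrow> expands P u"
    "finite Q" "\<And>u v. (u, v) \<in> set us \<Longrightarrow> expands Q v"
  by (rule tensor_cover[OF orthonormal_empty finite.emptyI orthonormal_empty finite.emptyI, of us]) (rule that)

text \<open>The given families are enlarged until they cover the list, where the norm is known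
  exactly; the added coordinates only increase the sum.\<close>

lemma tensor_bessel:
  fixes us :: "('h::complex_hilbert_space \<times> 'k::complex_hilbert_space) list"
  assumes "orthonormal e I" "finite I" "orthonormal f J" "finite J"
  shows "L2_set (\<lambda>(i, j). cmod (tensor_coeff us (e i) (f j))) (I \<times> J) \<le> hilbert_tensor_norm us"
proof -
  let ?g = "\<lambda>(p, q). (cmod (tensor_coeff us p q))\<^sup>2"
  obtain P Q where P: "e ` I \<subseteq> P" "finite P" "orthonormal (\<lambda>x. x) P" "\<And>u v. (u, v) \<in> set us \<Longrightarrow> expands P u"
    and Q: "f ` J \<subseteq> Q" "finite Q" "orthonormal (\<lambda>x. x) Q" "\<And>u v. (u, v) \<in> set us \<Longrightarrow> expands Q v"
    using tensor_cover[OF orthonormal_image(2)[OF assms(1)] _ orthonormal_image(2)[OF assms(3)], of us] assms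
    by blast
  have inj: "inj_on (map_prod e f) (I \<times> J)"
    by (intro map_prod_inj_on orthonormal_image(1) assms)
  have "(\<Sum>(i, j)\<in>I \<times> J. (cmod (tensor_coeff us (e i) (f j)))\<^sup>2) = sum ?g (map_prod e f ` (I \<times> J))"
    by (subst sum.reindex[OF inj]) (simp add: case_prod_unfold)
  also have "\<dots> \<le> sum ?g (P \<times> Q)"
    using P Q by (intro sum_mono2) auto
  finally show ?thesis
    using hilbert_tensor_norm_eq[OF P(2,4) Q(2,4), of us]
    by (simp add: L2_set_def case_prod_unfold)
qed

text \<open>Not automatic from the definition: \<open>sqrt\<close> is an odd function, so a negative
  radicand would give a negative value.\<close>

lemma hilbert_tensor_norm_nonneg: "0 \<le> hilbert_tensor_norm us"
  using tensor_bessel[of "\<lambda>x. x" "{}" "\<lambda>x. x" "{}" us] by (simp add: orthonormal_empty)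

lemma tensor_coeff_append: "tensor_coeff (us @ vs) p q = tensor_coeff us p q + tensor_coeff vs p q"
  by (simp add: tensor_coeff_def)

text \<open>Concatenation is addition of tensors; in coordinates that cover both lists this is the
  triangle inequality of \<open>L2_set\<close>.\<close>

lemma hilbert_tensor_norm_append:
  "hilbert_tensor_norm (us @ vs) \<le> hilbert_tensor_norm us + hilbert_tensor_norm vs"
proof -
  obtain P Q where P: "finite P" "\<And>u v. (u, v) \<in> set (us @ vs) \<Longrightarrow> expands P u"
    and Q: "finite Q" "\<And>u v. (u, v) \<in> set (us @ vs) \<Longrightarrow> expands Q v"
    by (rule tensor_cover_empty[of "us @ vs"]) (rule that)
  have eq: "hilbert_tensor_norm ws = L2_set (\<lambda>pq. cmod (tensor_coeff ws (fst pq) (snd pq))) (P \<times> Q)"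
    if "set ws \<subseteq> set (us @ vs)" for ws
  proof -
    have "hilbert_tensor_norm ws = L2_set (\<lambda>(p, q). cmod (tensor_coeff ws p q)) (P \<times> Q)"
      using P Q that by (intro hilbert_tensor_norm_eq) blast+
    then show ?thesis
      by (simp add: case_prod_unfold)
  qed
  have "hilbert_tensor_norm (us @ vs)
      \<le> L2_set (\<lambda>pq. cmod (tensor_coeff us (fst pq) (snd pq)) + cmod (tensor_coeff vs (fst pq) (snd pq))) (P \<times> Q)"
    by (subst eq) (auto simp: tensor_coeff_append norm_triangle_ineq intro!: L2_set_mono)
  also have "\<dots> \<le> hilbert_tensor_norm us + hilbert_tensor_norm vs"
    by (subst (1 2) eq) (simp_all add: L2_set_triangle_ineq)
  finally show ?thesis .
qed

section \<open>Operators acting on the tensor factors\<close>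

lemma bop_bounded_linear: "bounded_linear (bop_apply x)"
  using bop_apply[of x] by simp

lemma bop_apply_scaleC: "bop_apply x (c *\<^sub>C u) = c *\<^sub>C bop_apply x u"
  using bop_apply[of x] by simp

lemma bop_apply_add: "bop_apply x (u + v) = bop_apply x u + bop_apply x v"
  by (simp add: bop_bounded_linear linear_add bounded_linear.linear)

lemma bop_apply_zero: "bop_apply x 0 = 0"
  by (simp add: bop_bounded_linear linear_0 bounded_linear.linear)

lemma bop_apply_sum: "bop_apply x (sum f A) = (\<Sum>a\<in>A. bop_apply x (f a))"
  by (simp add: bop_bounded_linear linear_sum bounded_linear.linear)

lemma expands_zero: "expands P 0"
  by (simp add: expands_def)

lemma expands_add: "expands P u \<Longrightarrow> expands P v \<Longrightarrow> expands P (u + v)"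
  unfolding expands_def cinner_add_right scaleC_add_left sum.distrib by (rule arg_cong2)

lemma expands_scaleC:
  assumes "expands P u"
  shows "expands P (c *\<^sub>C u)"
proof -
  have "c *\<^sub>C u = c *\<^sub>C (\<Sum>p\<in>P. cinner p u *\<^sub>C p)"
    using assms by (simp add: expands_def)
  then show ?thesis
    unfolding expands_def cinner_scaleC_right by (simp only: complex_vector.scale_sum_right scaleC_scaleC)
qed

lemma expands_sum: "(\<And>a. a \<in> A \<Longrightarrow> expands P (f a)) \<Longrightarrow> expands P (sum f A)"
  by (induction A rule: infinite_finite_induct) (auto simp: expands_zero expands_add)

lemma expands_sum_list: "(\<And>a. a \<in> set as \<Longrightarrow> expands P (f a)) \<Longrightarrow> expands P (\<Sum>a\<leftarrow>as. f a)"
  by (induction as) (auto simp: expands_zero expands_add)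

lemma expands_member:
  assumes "orthonormal (\<lambda>x. x) P" "finite P" "u \<in> P"
  shows "expands P u"
proof -
  have "(\<Sum>p\<in>P. cinner p u *\<^sub>C p) = (\<Sum>p\<in>P. if p = u then u else 0)"
    using assms by (intro sum.cong) (auto simp: orthonormal_def scaleC_one)
  then show ?thesis
    using assms by (simp add: expands_def)
qed

text \<open>This is the bound for \<open>x \<otimes> 1\<close>. Fixing a basis vector
  \<open>q\<close> of the second factor cuts the tensor into slices \<open>w q\<close> in the first
  factor, and \<open>x \<otimes> 1\<close> acts on each slice as \<open>x\<close>.\<close>

lemma hilbert_tensor_norm_apply_left:
  assumes K: "\<And>u. norm (bop_apply x u) \<le> K * norm u"
  shows "hilbert_tensor_norm (map (\<lambda>(u, v). (bop_apply x u, v)) us) \<le> K * hilbert_tensor_norm us"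
proof -
  let ?vs = "map (\<lambda>(u, v). (bop_apply x u, v)) us"
  obtain P Q where on: "orthonormal (\<lambda>x. x) P"
    and P: "finite P" "\<And>u v. (u, v) \<in> set (us @ ?vs) \<Longrightarrow> expands P u"
    and Q: "finite Q" "\<And>u v. (u, v) \<in> set (us @ ?vs) \<Longrightarrow> expands Q v"
    by (rule tensor_cover_empty[of "us @ ?vs"]) (rule that)
  have K0: "0 \<le> K" if "u \<noteq> 0" for u :: 'a
    using order_trans[OF norm_ge_zero K[of u]] that by (simp add: zero_le_mult_iff)
  define w where "w q = (\<Sum>uv\<leftarrow>us. cinner q (snd uv) *\<^sub>C fst uv)" for q
  have w: "tensor_coeff us p q = cinner p (w q)" for p q
    by (simp add: tensor_coeff_def w_def cinner_sum_list_right cinner_scaleC_right case_prod_unfold mult.commute)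
  have "bop_apply x (w q) = (\<Sum>uv\<leftarrow>us. cinner q (snd uv) *\<^sub>C bop_apply x (fst uv))" for q
    unfolding w_def by (induction us) (simp_all add: bop_apply_zero bop_apply_add bop_apply_scaleC)
  then have xw: "tensor_coeff ?vs p q = cinner p (bop_apply x (w q))" for p q
    by (simp add: tensor_coeff_def cinner_sum_list_right cinner_scaleC_right case_prod_unfold mult.commute comp_def)
  have norm_w: "(norm (w q))\<^sup>2 = (\<Sum>p\<in>P. (cmod (cinner p (w q)))\<^sup>2)" for q
  proof -
    have "expands P (w q)"
      unfolding w_def using P(2)[of "fst uv" "snd uv" for uv] by (intro expands_sum_list expands_scaleC) simp
    then show ?thesis
      using norm_orthonormal_sum[OF on P(1), of "\<lambda>p. cinner p (w q)"] by (simp add: expands_def)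
  qed
  have "(\<Sum>p\<in>P. (cmod (tensor_coeff ?vs p q))\<^sup>2) \<le> K\<^sup>2 * (\<Sum>p\<in>P. (cmod (tensor_coeff us p q))\<^sup>2)" for q
  proof -
    have "(\<Sum>p\<in>P. (cmod (tensor_coeff ?vs p q))\<^sup>2) \<le> (norm (bop_apply x (w q)))\<^sup>2"
      unfolding xw using on P(1) by (rule bessel)
    also have "\<dots> \<le> (K * norm (w q))\<^sup>2"
      using K by (intro power_mono) auto
    finally show ?thesis
      by (simp add: w norm_w power_mult_distrib)
  qed
  then have "(\<Sum>q\<in>Q. \<Sum>p\<in>P. (cmod (tensor_coeff ?vs p q))\<^sup>2)
      \<le> K\<^sup>2 * (\<Sum>q\<in>Q. \<Sum>p\<in>P. (cmod (tensor_coeff us p q))\<^sup>2)"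
    unfolding sum_distrib_left by (rule sum_mono)
  then have "(\<Sum>pq\<in>P \<times> Q. (cmod (tensor_coeff ?vs (fst pq) (snd pq)))\<^sup>2)
      \<le> K\<^sup>2 * (\<Sum>pq\<in>P \<times> Q. (cmod (tensor_coeff us (fst pq) (snd pq)))\<^sup>2)"
    by (simp add: sum.cartesian_product' sum.swap[of _ P Q])
  moreover have eq: "hilbert_tensor_norm ws = sqrt (\<Sum>pq\<in>P \<times> Q. (cmod (tensor_coeff ws (fst pq) (snd pq)))\<^sup>2)"
    if "set ws \<subseteq> set (us @ ?vs)" for ws
  proof -
    have "hilbert_tensor_norm ws = L2_set (\<lambda>(p, q). cmod (tensor_coeff ws p q)) (P \<times> Q)"
      using P Q that by (intro hilbert_tensor_norm_eq) blast+
    then show ?thesis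
      by (simp add: L2_set_def case_prod_unfold)
  qed
  ultimately have "hilbert_tensor_norm ?vs \<le> \<bar>K\<bar> * hilbert_tensor_norm us"
    by (simp add: eq flip: real_sqrt_abs real_sqrt_mult)
  \<comment> \<open>\<open>K\<close> carries no sign condition; a negative \<open>K\<close> forces
    the space to be trivial, and then every tensor has norm 0.\<close>
  moreover have "hilbert_tensor_norm us = 0" if "K < 0"
  proof -
    have "u = 0" for u :: 'a
      using K0 that by fastforce
    then have "cinner u u' = 0" for u u' :: 'a
      by (metis cinner_zero_left)
    then show ?thesis
      by (simp add: hilbert_tensor_norm_def case_prod_unfold)
  qed
  ultimately show ?thesis
    by (cases "K < 0") simp_all
qed

lemma hilbert_tensor_norm_swap: "hilbert_tensor_norm (map prod.swap us) = hilbert_tensor_norm us"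
  by (simp add: hilbert_tensor_norm_def case_prod_unfold comp_def mult.commute)

text \<open>\<open>x \<otimes> y\<close> is the product of \<open>x \<otimes> 1\<close> and
  \<open>1 \<otimes> y\<close>; the latter is reduced to the former by exchanging the
  factors.\<close>

lemma hilbert_tensor_norm_apply_single:
  fixes x :: "'h::complex_hilbert_space bop" and y :: "'k::complex_hilbert_space bop"
  shows "\<exists>c\<ge>0. \<forall>us. hilbert_tensor_norm (map (\<lambda>(u, v). (bop_apply x u, bop_apply y v)) us)
    \<le> c * hilbert_tensor_norm us"
proof (intro exI conjI allI)
  fix us :: "('h \<times> 'k) list"
  have K: "norm (bop_apply z u) \<le> onorm (bop_apply z) * norm u" for z :: "'c::complex_hilbert_space bop" and u
    by (rule onorm[OF bop_bounded_linear])
  show "0 \<le> onorm (bop_apply x) * onorm (bop_apply y)"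
    by (simp add: onorm_pos_le bop_bounded_linear)
  let ?vs = "map (\<lambda>(v, u). (bop_apply y v, u)) (map prod.swap us)"
  have "map (\<lambda>(u, v). (bop_apply x u, bop_apply y v)) us = map (\<lambda>(u, v). (bop_apply x u, v)) (map prod.swap ?vs)"
    by (simp add: comp_def case_prod_unfold)
  then have "hilbert_tensor_norm (map (\<lambda>(u, v). (bop_apply x u, bop_apply y v)) us)
      \<le> onorm (bop_apply x) * hilbert_tensor_norm (map prod.swap ?vs)"
    by (simp only: hilbert_tensor_norm_apply_left[OF K])
  also have "\<dots> \<le> onorm (bop_apply x) * (onorm (bop_apply y) * hilbert_tensor_norm us)"
    using hilbert_tensor_norm_apply_left[OF K, of y "map prod.swap us"]
    by (intro mult_left_mono) (simp_all only: hilbert_tensor_norm_swap onorm_pos_le bop_bounded_linear)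
  finally show "hilbert_tensor_norm (map (\<lambda>(u, v). (bop_apply x u, bop_apply y v)) us)
      \<le> onorm (bop_apply x) * onorm (bop_apply y) * hilbert_tensor_norm us"
    by simp
qed

section \<open>The minimal tensor norm\<close>

text \<open>Guarantees that the infimum defining \<open>min_tensor_norm\<close> is taken over a
  nonempty set, without which it would carry no information.\<close>

lemma tensor_apply_bounded:
  "\<exists>c\<ge>0. \<forall>us. hilbert_tensor_norm (tensor_apply ts us) \<le> c * hilbert_tensor_norm us"
proof (induction ts)
  case Nil
  show ?case
    by (intro exI[of _ 0]) (simp add: tensor_apply_def hilbert_tensor_norm_def)
next
  case (Cons t ts)
  obtain x y where t: "t = (x, y)"
    by fastforce
  obtain c where c: "c \<ge> 0" "\<And>us. hilbert_tensor_norm (tensor_apply ts us) \<le> c * hilbert_tensor_norm us"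
    using Cons by blast
  obtain d where d: "d \<ge> 0"
    "\<And>us. hilbert_tensor_norm (map (\<lambda>(u, v). (bop_apply x u, bop_apply y v)) us) \<le> d * hilbert_tensor_norm us"
    using hilbert_tensor_norm_apply_single by metis
  have "tensor_apply (t # ts) us = map (\<lambda>(u, v). (bop_apply x u, bop_apply y v)) us @ tensor_apply ts us" for us
    by (simp add: t tensor_apply_def)
  then have "hilbert_tensor_norm (tensor_apply (t # ts) us) \<le> (d + c) * hilbert_tensor_norm us" for us
    using order_trans[OF hilbert_tensor_norm_append add_mono[OF d(2) c(2)]] by (simp add: distrib_right)
  then show ?case
    using c d by (intro exI[of _ "d + c"]) simp
qed

lemma le_Inf_mult:
  fixes S :: "real set"
  assumes "S \<noteq> {}" "\<And>c. c \<in> S \<Longrightarrow> a \<le> c * b" "0 \<le> b"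
  shows "a \<le> Inf S * b"
proof (cases "b = 0")
  case True
  with assms show ?thesis
    by fastforce
next
  case False
  with assms have "a / b \<le> Inf S"
    by (intro cInf_greatest) (auto simp: divide_simps)
  with False assms show ?thesis
    by (simp add: divide_simps)
qed

lemma hilbert_tensor_norm_tensor_apply:
  "hilbert_tensor_norm (tensor_apply ts us) \<le> min_tensor_norm ts * hilbert_tensor_norm us"
  unfolding min_tensor_norm_def
  using tensor_apply_bounded[of ts] by (intro le_Inf_mult) (auto simp: hilbert_tensor_norm_nonneg)

lemma min_tensor_norm_le:
  assumes "0 \<le> c" "\<And>us. hilbert_tensor_norm (tensor_apply ts us) \<le> c * hilbert_tensor_norm us"
  shows "min_tensor_norm ts \<le> c"
  unfolding min_tensor_norm_def using assms by (intro cInf_lower bdd_belowI[of _ 0]) auto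

lemma tensor_coeff_tensor_apply:
  "tensor_coeff (tensor_apply ts us) p q
    = (\<Sum>(x, y)\<leftarrow>ts. \<Sum>(u, v)\<leftarrow>us. cinner p (bop_apply x u) * cinner q (bop_apply y v))"
  by (induction ts) (auto simp: tensor_apply_def tensor_coeff_def comp_def case_prod_unfold)

text \<open>The sum is the entry of the operator between the unit vectors
  \<open>f \<otimes> f'\<close> and \<open>e \<otimes> e'\<close>; thus a product of two entry
  functionals satisfies the integral estimate with constant 1.\<close>

lemma cmod_entry_sum_le:
  assumes "norm e = 1" "norm f = 1" "norm e' = 1" "norm f' = 1"
  shows "cmod (\<Sum>(x, y)\<leftarrow>ts. cinner e (bop_apply x f) * cinner e' (bop_apply y f')) \<le> min_tensor_norm ts"
proof -
  let ?us = "tensor_apply ts [(f, f')]"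
  have [simp]: "orthonormal (\<lambda>_. e) {()}" "orthonormal (\<lambda>_. e') {()}"
    using assms by (simp_all add: orthonormal_def cinner_norm)
  have "(\<Sum>(x, y)\<leftarrow>ts. cinner e (bop_apply x f) * cinner e' (bop_apply y f')) = tensor_coeff ?us e e'"
    by (simp add: tensor_coeff_tensor_apply)
  then have "cmod (\<Sum>(x, y)\<leftarrow>ts. cinner e (bop_apply x f) * cinner e' (bop_apply y f')) \<le> hilbert_tensor_norm ?us"
    using tensor_bessel[of "\<lambda>_. e" "{()}" "\<lambda>_. e'" "{()}" ?us] by simp
  also have "\<dots> \<le> min_tensor_norm ts * hilbert_tensor_norm [(f, f')]"
    by (rule hilbert_tensor_norm_tensor_apply)
  also have "hilbert_tensor_norm [(f, f')] = 1"
    using assms by (simp add: hilbert_tensor_norm_def cinner_norm)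
  finally show ?thesis
    by simp
qed

section \<open>Jointly completely bounded forms\<close>

lemma block_norm_bound:
  assumes I: "finite I" and T: "\<And>i j. bounded_linear (T i j)"
  shows "L2_set (\<lambda>i. norm (\<Sum>j\<in>I. T i j (\<xi> j))) I \<le> block_norm I T * L2_set (\<lambda>j. norm (\<xi> j)) I"
    and block_norm_nonneg: "0 \<le> block_norm I T"
proof -
  let ?S = "{c. 0 \<le> c \<and> (\<forall>\<xi>. L2_set (\<lambda>i. norm (\<Sum>j\<in>I. T i j (\<xi> j))) I \<le> c * L2_set (\<lambda>j. norm (\<xi> j)) I)}"
  \<comment> \<open>A crude constant, whose only purpose is that the infimum is taken over a
    nonempty set.\<close>
  define c where "c = (\<Sum>i\<in>I. \<Sum>j\<in>I. onorm (T i j))"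
  have "L2_set (\<lambda>i. norm (\<Sum>j\<in>I. T i j (\<xi> j))) I \<le> c * L2_set (\<lambda>j. norm (\<xi> j)) I" for \<xi>
  proof -
    have "L2_set (\<lambda>i. norm (\<Sum>j\<in>I. T i j (\<xi> j))) I \<le> (\<Sum>i\<in>I. norm (\<Sum>j\<in>I. T i j (\<xi> j)))"
      by (rule L2_set_le_sum) simp
    also have "\<dots> \<le> (\<Sum>i\<in>I. \<Sum>j\<in>I. onorm (T i j) * L2_set (\<lambda>j. norm (\<xi> j)) I)"
    proof (rule sum_mono)
      fix i
      have "norm (T i j (\<xi> j)) \<le> onorm (T i j) * L2_set (\<lambda>j. norm (\<xi> j)) I" if "j \<in> I" for j
        using order_trans[OF onorm[OF T] mult_left_mono[OF member_le_L2_set[OF I that] onorm_pos_le[OF T]]] .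
      then show "norm (\<Sum>j\<in>I. T i j (\<xi> j)) \<le> (\<Sum>j\<in>I. onorm (T i j) * L2_set (\<lambda>j. norm (\<xi> j)) I)"
        by (rule sum_norm_le)
    qed
    finally show ?thesis
      by (simp add: c_def sum_distrib_right)
  qed
  moreover have "0 \<le> c"
    unfolding c_def by (intro sum_nonneg onorm_pos_le T)
  ultimately have ne: "?S \<noteq> {}"
    by blast
  show "L2_set (\<lambda>i. norm (\<Sum>j\<in>I. T i j (\<xi> j))) I \<le> block_norm I T * L2_set (\<lambda>j. norm (\<xi> j)) I"
    unfolding block_norm_def using ne by (intro le_Inf_mult) auto
  show "0 \<le> block_norm I T"
    unfolding block_norm_def using ne by (intro cInf_greatest) auto
qed

lemma block_norm_le:
  assumes "0 \<le> c" "\<And>\<xi>. L2_set (\<lambda>i. norm (\<Sum>j\<in>I. T i j (\<xi> j))) I \<le> c * L2_set (\<lambda>j. norm (\<xi> j)) I"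
  shows "block_norm I T \<le> c"
  unfolding block_norm_def using assms by (intro cInf_lower bdd_belowI[of _ 0]) auto

lemma block_norm_bound_sq:
  assumes "finite I"
  shows "(\<Sum>i\<in>I. (norm (\<Sum>j\<in>I. bop_apply (a i j) (\<xi> j)))\<^sup>2)
    \<le> (block_norm I (\<lambda>i j. bop_apply (a i j)))\<^sup>2 * (\<Sum>j\<in>I. (norm (\<xi> j))\<^sup>2)"
proof -
  have "(L2_set (\<lambda>i. norm (\<Sum>j\<in>I. bop_apply (a i j) (\<xi> j))) I)\<^sup>2
      \<le> (block_norm I (\<lambda>i j. bop_apply (a i j)) * L2_set (\<lambda>j. norm (\<xi> j)) I)\<^sup>2"
    using assms by (intro power_mono block_norm_bound bop_bounded_linear L2_set_nonneg)
  then show ?thesis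
    by (simp add: L2_set_def power_mult_distrib sum_nonneg)
qed

section \<open>Amplifications and the calculus of jcb bounds\<close>

lemma matrix_alg_norm_nonneg: "0 \<le> matrix_alg_norm m as"
  unfolding matrix_alg_norm_def by (intro block_norm_nonneg bop_bounded_linear) simp

text \<open>Entry of the amplified form in row \<open>(i, i')\<close> and column
  \<open>(j, j')\<close>; the arguments are grouped by matrix factor.\<close>

definition kron_coeff ::
  "('a \<Rightarrow> 'b \<Rightarrow> complex) \<Rightarrow> ('a \<times> (nat \<Rightarrow> nat \<Rightarrow> complex)) list \<Rightarrow> ('b \<times> (nat \<Rightarrow> nat \<Rightarrow> complex)) list
    \<Rightarrow> nat \<Rightarrow> nat \<Rightarrow> nat \<Rightarrow> nat \<Rightarrow> complex" where
  "kron_coeff B as bs i j i' j' = (\<Sum>(a, x)\<leftarrow>as. \<Sum>(b, y)\<leftarrow>bs. B a b * (x i j * y i' j'))"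

text \<open>Stated on vectors \<xi> instead of through an infimum, which makes it stable under sums,
  multiples and pointwise limits.\<close>

definition jcb_at_most ::
  "real \<Rightarrow> ('h::complex_hilbert_space bop \<Rightarrow> 'k::complex_hilbert_space bop \<Rightarrow> complex) \<Rightarrow> bool" where
  "jcb_at_most C B \<longleftrightarrow> (\<forall>m as bs \<xi>.
     L2_set (\<lambda>(i, i'). cmod (\<Sum>(j, j')\<in>{..<m} \<times> {..<m}. kron_coeff B as bs i j i' j' * \<xi> j j')) ({..<m} \<times> {..<m})
     \<le> C * matrix_alg_norm m as * matrix_alg_norm m bs * L2_set (\<lambda>(j, j'). cmod (\<xi> j j')) ({..<m} \<times> {..<m}))"

lemma jcb_bounds_member:
  assumes "0 \<le> C" "jcb_at_most C B"
  shows "C \<in> jcb_bounds B"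
  unfolding jcb_bounds_def kronecker_norm_def
proof (intro CollectI conjI allI block_norm_le)
  fix m as bs and \<xi> :: "nat \<times> nat \<Rightarrow> complex"
  have "(\<Sum>(b, x, y)\<leftarrow>[(B a b, x, y). (a, x) \<leftarrow> as, (b, y) \<leftarrow> bs]. b * (x i j * y i' j'))
      = kron_coeff B as bs i j i' j'" for i j i' j'
    unfolding kron_coeff_def by (induction as) (auto simp: comp_def case_prod_unfold)
  then show "L2_set (\<lambda>ii. norm (\<Sum>jj\<in>{..<m} \<times> {..<m}. (case ii of (i, i') \<Rightarrow> \<lambda>(j, j') z.
        (\<Sum>(b, x, y)\<leftarrow>[(B a b, x, y). (a, x) \<leftarrow> as, (b, y) \<leftarrow> bs]. b * (x i j * y i' j')) * z) jj (\<xi> jj)))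
      ({..<m} \<times> {..<m})
    \<le> C * matrix_alg_norm m as * matrix_alg_norm m bs * L2_set (\<lambda>jj. norm (\<xi> jj)) ({..<m} \<times> {..<m})"
    using assms(2)[unfolded jcb_at_most_def, rule_format,
        where m = m and as = as and bs = bs and \<xi> = "\<lambda>j j'. \<xi> (j, j')"]
    by (simp add: case_prod_unfold)
qed (use assms in \<open>simp_all add: matrix_alg_norm_nonneg\<close>)

lemma jcb_at_most_iff:
  assumes "0 \<le> C"
  shows "jcb_at_most C B \<longleftrightarrow> (\<forall>m as bs \<xi>.
    (\<Sum>i<m. \<Sum>i'<m. (cmod (\<Sum>j<m. \<Sum>j'<m. kron_coeff B as bs i j i' j' * \<xi> j j'))\<^sup>2)
    \<le> (C * matrix_alg_norm m as * matrix_alg_norm m bs)\<^sup>2 * (\<Sum>j<m. \<Sum>j'<m. (cmod (\<xi> j j'))\<^sup>2))"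
proof -
  have "sqrt x \<le> c * sqrt y \<longleftrightarrow> x \<le> c\<^sup>2 * y" if "0 \<le> c" for x y c :: real
  proof -
    have "c * sqrt y = sqrt (c\<^sup>2 * y)"
      using that by (simp add: real_sqrt_mult)
    then show ?thesis
      by (simp only: real_sqrt_le_iff)
  qed
  then show ?thesis
    unfolding jcb_at_most_def L2_set_def
    using assms by (simp add: matrix_alg_norm_nonneg sum.cartesian_product case_prod_unfold)
qed

text \<open>The flip of the two matrix factors is unitary. The estimate for entry functionals below
  is asymmetric, with rows counted in one factor and columns in the other; this lemma makes both
  choices available.\<close>

lemma jcb_at_most_swap:
  assumes "0 \<le> C" "jcb_at_most C B"
  shows "jcb_at_most C (\<lambda>b a. B a b)"
  unfolding jcb_at_most_iff[OF assms(1)]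
proof (intro allI)
  fix m bs as and \<xi> :: "nat \<Rightarrow> nat \<Rightarrow> complex"
  have k: "kron_coeff (\<lambda>b a. B a b) bs as i' j' i j = kron_coeff B as bs i j i' j'" for i j i' j'
    unfolding kron_coeff_def case_prod_unfold
  proof (induction bs)
    case (Cons b bs)
    then show ?case
      by (simp add: sum_list_addf mult.commute)
  qed simp
  have "(\<Sum>i'<m. \<Sum>i<m. (cmod (\<Sum>j'<m. \<Sum>j<m. kron_coeff (\<lambda>b a. B a b) bs as i' j' i j * \<xi> j' j))\<^sup>2)
    = (\<Sum>i<m. \<Sum>i'<m. (cmod (\<Sum>j<m. \<Sum>j'<m. kron_coeff B as bs i j i' j' * \<xi> j' j))\<^sup>2)"
    unfolding k by (subst sum.swap) (intro sum.cong refl arg_cong[where f = "\<lambda>z. (cmod z)\<^sup>2"] sum.swap)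
  also have "\<dots> \<le> (C * matrix_alg_norm m as * matrix_alg_norm m bs)\<^sup>2 * (\<Sum>j<m. \<Sum>j'<m. (cmod (\<xi> j' j))\<^sup>2)"
    using iffD1[OF jcb_at_most_iff[OF assms(1)] assms(2), rule_format,
        where m = m and as = as and bs = bs and \<xi> = "\<lambda>j j'. \<xi> j' j"] .
  also have "(\<Sum>j<m. \<Sum>j'<m. (cmod (\<xi> j' j))\<^sup>2) = (\<Sum>j'<m. \<Sum>j<m. (cmod (\<xi> j' j))\<^sup>2)"
    by (rule sum.swap)
  finally show "(\<Sum>i'<m. \<Sum>i<m. (cmod (\<Sum>j'<m. \<Sum>j<m. kron_coeff (\<lambda>b a. B a b) bs as i' j' i j * \<xi> j' j))\<^sup>2)
    \<le> (C * matrix_alg_norm m bs * matrix_alg_norm m as)\<^sup>2 * (\<Sum>j'<m. \<Sum>j<m. (cmod (\<xi> j' j))\<^sup>2)"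
    by (simp add: mult_ac)
qed

lemma jcb_at_most_zero: "jcb_at_most 0 (\<lambda>a b. 0)"
  by (simp add: jcb_at_most_def kron_coeff_def case_prod_unfold L2_set_def)

lemma jcb_at_most_add:
  fixes G H :: "'h::complex_hilbert_space bop \<Rightarrow> 'k::complex_hilbert_space bop \<Rightarrow> complex"
  assumes "jcb_at_most C G" "jcb_at_most D H"
  shows "jcb_at_most (C + D) (\<lambda>a b. G a b + H a b)"
  unfolding jcb_at_most_def
proof (intro allI)
  fix m and as :: "('h bop \<times> (nat \<Rightarrow> nat \<Rightarrow> complex)) list" and bs :: "('k bop \<times> (nat \<Rightarrow> nat \<Rightarrow> complex)) list"
    and \<xi> :: "nat \<Rightarrow> nat \<Rightarrow> complex"
  let ?I = "{..<m} \<times> {..<m} :: (nat \<times> nat) set"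
  let ?V = "\<lambda>B (i, i'). \<Sum>(j, j')\<in>?I. kron_coeff B as bs i j i' j' * \<xi> j j'"
  have "kron_coeff (\<lambda>a b. G a b + H a b) as bs i j i' j' = kron_coeff G as bs i j i' j' + kron_coeff H as bs i j i' j'"
    for i j i' j'
    by (simp add: kron_coeff_def case_prod_unfold distrib_right sum_list_addf)
  then have "?V (\<lambda>a b. G a b + H a b) ii = ?V G ii + ?V H ii" for ii
    by (simp add: case_prod_unfold distrib_right sum.distrib)
  then have "L2_set (\<lambda>ii. cmod (?V (\<lambda>a b. G a b + H a b) ii)) ?I \<le> L2_set (\<lambda>ii. cmod (?V G ii) + cmod (?V H ii)) ?I"
    by (intro L2_set_mono) (simp_all add: norm_triangle_ineq)
  also have "\<dots> \<le> L2_set (\<lambda>ii. cmod (?V G ii)) ?I + L2_set (\<lambda>ii. cmod (?V H ii)) ?I"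
    by (rule L2_set_triangle_ineq)
  also have "\<dots> \<le> C * matrix_alg_norm m as * matrix_alg_norm m bs * L2_set (\<lambda>(j, j'). cmod (\<xi> j j')) ?I
      + D * matrix_alg_norm m as * matrix_alg_norm m bs * L2_set (\<lambda>(j, j'). cmod (\<xi> j j')) ?I"
    using assms unfolding jcb_at_most_def case_prod_unfold by (intro add_mono) blast+
  finally show "L2_set (\<lambda>(i, i'). cmod (\<Sum>(j, j')\<in>?I. kron_coeff (\<lambda>a b. G a b + H a b) as bs i j i' j' * \<xi> j j')) ?I
    \<le> (C + D) * matrix_alg_norm m as * matrix_alg_norm m bs * L2_set (\<lambda>(j, j'). cmod (\<xi> j j')) ?I"
    by (simp add: case_prod_unfold algebra_simps)
qed

lemma jcb_at_most_sum:
  assumes "\<And>s. s \<in> S \<Longrightarrow> jcb_at_most (C s) (G s)"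
  shows "jcb_at_most (sum C S) (\<lambda>a b. \<Sum>s\<in>S. G s a b)"
  using assms
proof (induction S rule: infinite_finite_induct)
  case (insert s S)
  then show ?case
    using jcb_at_most_add[of "C s" "G s" "sum C S" "\<lambda>a b. \<Sum>s\<in>S. G s a b"] by simp
qed (simp_all add: jcb_at_most_zero)

lemma jcb_at_most_mono:
  assumes "jcb_at_most C G" "C \<le> D"
  shows "jcb_at_most D G"
  unfolding jcb_at_most_def
  by (intro allI order_trans[OF assms(1)[unfolded jcb_at_most_def, rule_format]] mult_right_mono assms(2)
      matrix_alg_norm_nonneg L2_set_nonneg)

lemma jcb_at_most_scale:
  fixes G :: "'h::complex_hilbert_space bop \<Rightarrow> 'k::complex_hilbert_space bop \<Rightarrow> complex"
  assumes "jcb_at_most C G"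
  shows "jcb_at_most (cmod c * C) (\<lambda>a b. c * G a b)"
  unfolding jcb_at_most_def
proof (intro allI)
  fix m and as :: "('h bop \<times> (nat \<Rightarrow> nat \<Rightarrow> complex)) list" and bs :: "('k bop \<times> (nat \<Rightarrow> nat \<Rightarrow> complex)) list"
    and \<xi> :: "nat \<Rightarrow> nat \<Rightarrow> complex"
  let ?I = "{..<m} \<times> {..<m} :: (nat \<times> nat) set"
  have "kron_coeff (\<lambda>a b. c * G a b) as bs i j i' j' = c * kron_coeff G as bs i j i' j'" for i j i' j'
    by (simp add: kron_coeff_def case_prod_unfold mult.assoc sum_list_const_mult)
  then have "L2_set (\<lambda>(i, i'). cmod (\<Sum>(j, j')\<in>?I. kron_coeff (\<lambda>a b. c * G a b) as bs i j i' j' * \<xi> j j')) ?I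
      = cmod c * L2_set (\<lambda>(i, i'). cmod (\<Sum>(j, j')\<in>?I. kron_coeff G as bs i j i' j' * \<xi> j j')) ?I"
    by (simp add: L2_set_right_distrib case_prod_unfold mult.assoc flip: sum_distrib_left norm_mult)
  also have "\<dots> \<le> cmod c * (C * matrix_alg_norm m as * matrix_alg_norm m bs * L2_set (\<lambda>(j, j'). cmod (\<xi> j j')) ?I)"
    using assms unfolding jcb_at_most_def by (intro mult_left_mono) auto
  finally show "L2_set (\<lambda>(i, i'). cmod (\<Sum>(j, j')\<in>?I. kron_coeff (\<lambda>a b. c * G a b) as bs i j i' j' * \<xi> j j')) ?I
    \<le> cmod c * C * matrix_alg_norm m as * matrix_alg_norm m bs * L2_set (\<lambda>(j, j'). cmod (\<xi> j j')) ?I"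
    by (simp add: mult_ac)
qed

lemma tendsto_sum_list:
  "(\<And>x. (f x \<longlongrightarrow> g x) F) \<Longrightarrow> ((\<lambda>N. \<Sum>x\<leftarrow>xs. f x N) \<longlongrightarrow> (\<Sum>x\<leftarrow>xs. g x :: 'a::topological_monoid_add)) F"
  by (induction xs) (auto intro: tendsto_add)

text \<open>For fixed matrices and a fixed vector only finitely many values of the form enter, so
  pointwise convergence is enough.\<close>

lemma jcb_at_most_limit:
  assumes G: "\<And>N. jcb_at_most C (G N)" and lim: "\<And>a b. (\<lambda>N. G N a b) \<longlonglongrightarrow> H a b"
  shows "jcb_at_most C H"
  unfolding jcb_at_most_def
proof (intro allI)
  fix m as bs and \<xi> :: "nat \<Rightarrow> nat \<Rightarrow> complex"
  have k: "(\<lambda>N. kron_coeff (G N) as bs i j i' j') \<longlonglongrightarrow> kron_coeff H as bs i j i' j'" for i j i' j'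
    unfolding kron_coeff_def case_prod_unfold by (intro tendsto_sum_list tendsto_intros lim)
  show "L2_set (\<lambda>(i, i'). cmod (\<Sum>(j, j')\<in>{..<m} \<times> {..<m}. kron_coeff H as bs i j i' j' * \<xi> j j')) ({..<m} \<times> {..<m})
    \<le> C * matrix_alg_norm m as * matrix_alg_norm m bs * L2_set (\<lambda>(j, j'). cmod (\<xi> j j')) ({..<m} \<times> {..<m})"
  proof (rule LIMSEQ_le_const2)
    show "(\<lambda>N. L2_set (\<lambda>(i, i'). cmod (\<Sum>(j, j')\<in>{..<m} \<times> {..<m}. kron_coeff (G N) as bs i j i' j' * \<xi> j j')) ({..<m} \<times> {..<m}))
      \<longlonglongrightarrow> L2_set (\<lambda>(i, i'). cmod (\<Sum>(j, j')\<in>{..<m} \<times> {..<m}. kron_coeff H as bs i j i' j' * \<xi> j j')) ({..<m} \<times> {..<m})"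
      unfolding L2_set_def case_prod_unfold by (intro tendsto_intros k)
  qed (use G in \<open>auto simp: jcb_at_most_def\<close>)
qed

text \<open>Amplification by the 1 by 1 matrix 1. The bound is uniform over all forms with the same
  \<open>C\<close> and will make a weighted series of forms converge.\<close>

lemma jcb_at_most_cmod:
  assumes "jcb_at_most C B"
  shows "cmod (B a b) \<le> C * matrix_alg_norm 1 [(a, \<lambda>_ _. 1)] * matrix_alg_norm 1 [(b, \<lambda>_ _. 1)]"
proof -
  have [simp]: "{..<Suc 0} \<times> {..<Suc 0} = {(0, 0)}"
    by auto
  show ?thesis
    using assms[unfolded jcb_at_most_def, rule_format,
        where m = 1 and as = "[(a, \<lambda>_ _. 1)]" and bs = "[(b, \<lambda>_ _. 1)]" and \<xi> = "\<lambda>_ _. 1"]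
    by (simp add: kron_coeff_def)
qed

section \<open>Row and column estimates for matrix entries\<close>

lemma orthonormal_fiber:
  assumes "orthonormal e (\<rho> ` S)" "inj_on (\<lambda>s. (\<rho> s, \<gamma> s)) S"
  shows "orthonormal (\<lambda>s. e (\<rho> s)) {s \<in> S. \<gamma> s = c}"
  unfolding orthonormal_def
proof (intro ballI)
  fix s t assume st: "s \<in> {s \<in> S. \<gamma> s = c}" "t \<in> {s \<in> S. \<gamma> s = c}"
  then have "\<rho> s = \<rho> t \<longleftrightarrow> s = t"
    using assms(2) by (auto simp: inj_on_def)
  with st show "cinner (e (\<rho> s)) (e (\<rho> t)) = of_bool (s = t)"
    using orthonormal_cinner[OF assms(1), of "\<rho> s" "\<rho> t"] by simp
qed

lemma cmod_sum_squared_le: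
  "(cmod (\<Sum>r\<in>R. t r))\<^sup>2 \<le> real (card R) * (\<Sum>r\<in>R. (cmod (t r))\<^sup>2)"
proof -
  have "(cmod (\<Sum>r\<in>R. t r))\<^sup>2 \<le> (\<Sum>r\<in>R. cmod (t r))\<^sup>2"
    by (intro power_mono norm_sum) simp
  also have "\<dots> \<le> (\<Sum>r\<in>R. (cmod (t r))\<^sup>2) * real (card R)"
    by (rule sum_squared_le_sum_of_squares)
  finally show ?thesis
    by (simp add: mult.commute)
qed

text \<open>The operator estimated is the row of the entry matrices \<open>X\<^sub>s\<close> of
  \<open>a\<close>. Entries in the same matrix row \<open>r\<close> are combined into one vector
  \<zeta>, whose norm is known because the columns met within a row are orthonormal; then a single
  functional per \<open>r\<close> is evaluated. Cauchy-Schwarz over the rows costs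
  \<open>card R\<close>, however many entries there are.\<close>

lemma row_bound:
  fixes a :: "'i \<Rightarrow> 'i \<Rightarrow> 'h::complex_hilbert_space bop"
  assumes fin: "finite I" "finite S" "finite R" and R: "\<rho> ` S \<subseteq> R" "\<And>r. r \<in> R \<Longrightarrow> norm (e r) = 1"
    and f: "orthonormal f (\<gamma> ` S)" and inj: "inj_on (\<lambda>s. (\<rho> s, \<gamma> s)) S"
  shows "(\<Sum>i\<in>I. (cmod (\<Sum>j\<in>I. \<Sum>s\<in>S. cinner (e (\<rho> s)) (bop_apply (a i j) (f (\<gamma> s))) * z s j))\<^sup>2)
    \<le> card R * (block_norm I (\<lambda>i j. bop_apply (a i j)))\<^sup>2 * (\<Sum>j\<in>I. \<Sum>s\<in>S. (cmod (z s j))\<^sup>2)"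
proof -
  define \<zeta> where "\<zeta> r j = (\<Sum>s\<in>{s\<in>S. \<rho> s = r}. z s j *\<^sub>C f (\<gamma> s))" for r j
  have norm_\<zeta>: "(norm (\<zeta> r j))\<^sup>2 = (\<Sum>s\<in>{s\<in>S. \<rho> s = r}. (cmod (z s j))\<^sup>2)" for r j
  proof -
    have "inj_on (\<lambda>s. (\<gamma> s, \<rho> s)) S"
      using inj by (auto simp: inj_on_def)
    then show ?thesis
      unfolding \<zeta>_def using fin by (intro norm_orthonormal_sum orthonormal_fiber[OF f]) auto
  qed
  have "(\<Sum>s\<in>S. cinner (e (\<rho> s)) (bop_apply (a i j) (f (\<gamma> s))) * z s j) = (\<Sum>r\<in>R. cinner (e r) (bop_apply (a i j) (\<zeta> r j)))"
    for i j
    unfolding \<zeta>_def bop_apply_sum bop_apply_scaleC cinner_sum_right cinner_scaleC_right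
    by (subst sum.group[OF fin(2,3) R(1), symmetric]) (auto intro!: sum.cong)
  then have "(\<Sum>i\<in>I. (cmod (\<Sum>j\<in>I. \<Sum>s\<in>S. cinner (e (\<rho> s)) (bop_apply (a i j) (f (\<gamma> s))) * z s j))\<^sup>2)
      = (\<Sum>i\<in>I. (cmod (\<Sum>r\<in>R. cinner (e r) (\<Sum>j\<in>I. bop_apply (a i j) (\<zeta> r j))))\<^sup>2)"
    by (simp add: cinner_sum_right sum.swap[of _ R I])
  also have "\<dots> \<le> (\<Sum>i\<in>I. card R * (\<Sum>r\<in>R. (norm (\<Sum>j\<in>I. bop_apply (a i j) (\<zeta> r j)))\<^sup>2))"
    by (intro sum_mono order_trans[OF cmod_sum_squared_le] mult_left_mono power_mono cmod_cinner_unit R(2)) simp_all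
  also have "\<dots> = card R * (\<Sum>r\<in>R. \<Sum>i\<in>I. (norm (\<Sum>j\<in>I. bop_apply (a i j) (\<zeta> r j)))\<^sup>2)"
    by (simp add: sum_distrib_left[symmetric] sum.swap[of _ I R])
  also have "\<dots> \<le> card R * (\<Sum>r\<in>R. (block_norm I (\<lambda>i j. bop_apply (a i j)))\<^sup>2 * (\<Sum>j\<in>I. (norm (\<zeta> r j))\<^sup>2))"
    by (intro mult_left_mono sum_mono block_norm_bound_sq fin) simp
  also have "\<dots> = card R * (block_norm I (\<lambda>i j. bop_apply (a i j)))\<^sup>2 * (\<Sum>j\<in>I. \<Sum>r\<in>R. (norm (\<zeta> r j))\<^sup>2)"
    by (simp add: sum_distrib_left[symmetric] sum.swap[of _ I R])
  also have "(\<lambda>j. \<Sum>r\<in>R. (norm (\<zeta> r j))\<^sup>2) = (\<lambda>j. \<Sum>s\<in>S. (cmod (z s j))\<^sup>2)"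
    unfolding norm_\<zeta> by (intro ext sum.group[OF fin(2,3) R(1)])
  finally show ?thesis .
qed

text \<open>The dual estimate, for the column of the entry matrices; here \<open>R\<close> collects
  matrix columns. For each \<open>f r\<close> the image under \<open>b\<close> is formed once, and
  Bessel's inequality bounds its coordinates in all rows together.\<close>

lemma col_bound:
  fixes b :: "'i \<Rightarrow> 'i \<Rightarrow> 'h::complex_hilbert_space bop"
  assumes fin: "finite I" "finite S" "finite R" and R: "\<gamma> ` S \<subseteq> R" "\<And>r. r \<in> R \<Longrightarrow> norm (f r) = 1"
    and e: "orthonormal e (\<rho> ` S)" and inj: "inj_on (\<lambda>s. (\<rho> s, \<gamma> s)) S"
  shows "(\<Sum>i\<in>I. \<Sum>s\<in>S. (cmod (\<Sum>j\<in>I. cinner (e (\<rho> s)) (bop_apply (b i j) (f (\<gamma> s))) * \<xi> j))\<^sup>2)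
    \<le> card R * (block_norm I (\<lambda>i j. bop_apply (b i j)))\<^sup>2 * (\<Sum>j\<in>I. (cmod (\<xi> j))\<^sup>2)"
proof -
  define v where "v i r = (\<Sum>j\<in>I. bop_apply (b i j) (\<xi> j *\<^sub>C f r))" for i r
  have v: "(\<Sum>j\<in>I. cinner (e (\<rho> s)) (bop_apply (b i j) (f (\<gamma> s))) * \<xi> j) = cinner (e (\<rho> s)) (v i (\<gamma> s))" for i s
    by (simp add: v_def bop_apply_scaleC cinner_sum_right cinner_scaleC_right mult.commute)
  have "(\<Sum>i\<in>I. \<Sum>s\<in>S. (cmod (\<Sum>j\<in>I. cinner (e (\<rho> s)) (bop_apply (b i j) (f (\<gamma> s))) * \<xi> j))\<^sup>2)
      = (\<Sum>r\<in>R. \<Sum>i\<in>I. \<Sum>s\<in>{s\<in>S. \<gamma> s = r}. (cmod (cinner (e (\<rho> s)) (v i r)))\<^sup>2)"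
    unfolding v by (subst sum.group[OF fin(2,3) R(1), symmetric]) (simp add: sum.swap[of _ R I])
  also have "\<dots> \<le> (\<Sum>r\<in>R. \<Sum>i\<in>I. (norm (v i r))\<^sup>2)"
    using fin by (intro sum_mono bessel orthonormal_fiber[OF e inj]) simp
  also have "\<dots> \<le> (\<Sum>r\<in>R. (block_norm I (\<lambda>i j. bop_apply (b i j)))\<^sup>2 * (\<Sum>j\<in>I. (cmod (\<xi> j))\<^sup>2))"
  proof (rule sum_mono)
    fix r assume "r \<in> R"
    then show "(\<Sum>i\<in>I. (norm (v i r))\<^sup>2) \<le> (block_norm I (\<lambda>i j. bop_apply (b i j)))\<^sup>2 * (\<Sum>j\<in>I. (cmod (\<xi> j))\<^sup>2)"
      using block_norm_bound_sq[OF fin(1), of b "\<lambda>j. \<xi> j *\<^sub>C f r"] by (simp add: v_def norm_scaleC R(2))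
  qed
  finally show ?thesis
    by simp
qed

text \<open>Writing the form as \<open>\<Sum>\<^sub>s X\<^sub>s \<otimes> Y\<^sub>s\<close>, its amplification is bounded by
  \<open>\<parallel>\<Sum>\<^sub>s X\<^sub>s X\<^sub>s\<^sup>*\<parallel>\<^sup>1\<^sup>/\<^sup>2 \<parallel>\<Sum>\<^sub>s Y\<^sub>s\<^sup>* Y\<^sub>s\<parallel>\<^sup>1\<^sup>/\<^sup>2\<close>; only the number of rows
  met by the \<open>X\<^sub>s\<close> and the number of columns met by the \<open>Y\<^sub>s\<close> enter.\<close>

lemma jcb_at_most_entries:
  fixes e f :: "'i \<Rightarrow> 'h::complex_hilbert_space" and e' f' :: "'i \<Rightarrow> 'k::complex_hilbert_space"
  assumes fin: "finite S" "finite R" "finite T"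
    and R: "\<rho> ` S \<subseteq> R" "\<And>r. r \<in> R \<Longrightarrow> norm (e r) = 1"
    and f: "orthonormal f (\<gamma> ` S)" and inj: "inj_on (\<lambda>s. (\<rho> s, \<gamma> s)) S"
    and T: "\<gamma>' ` S \<subseteq> T" "\<And>r. r \<in> T \<Longrightarrow> norm (f' r) = 1"
    and e': "orthonormal e' (\<rho>' ` S)" and inj': "inj_on (\<lambda>s. (\<rho>' s, \<gamma>' s)) S"
  shows "jcb_at_most (sqrt (card R * card T))
    (\<lambda>a b. \<Sum>s\<in>S. cinner (e (\<rho> s)) (bop_apply a (f (\<gamma> s))) * cinner (e' (\<rho>' s)) (bop_apply b (f' (\<gamma>' s))))"
    (is "jcb_at_most _ ?G")
proof (subst jcb_at_most_iff; (intro allI)?)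
  fix m and as :: "('h bop \<times> (nat \<Rightarrow> nat \<Rightarrow> complex)) list" and bs :: "('k bop \<times> (nat \<Rightarrow> nat \<Rightarrow> complex)) list"
    and \<xi> :: "nat \<Rightarrow> nat \<Rightarrow> complex"
  define a where "a i j = (\<Sum>(a, x)\<leftarrow>as. x i j *\<^sub>C a)" for i j
  define b where "b i j = (\<Sum>(b, y)\<leftarrow>bs. y i j *\<^sub>C b)" for i j
  define X where "X s i j = cinner (e (\<rho> s)) (bop_apply (a i j) (f (\<gamma> s)))" for s i j
  define Y where "Y s i j = cinner (e' (\<rho>' s)) (bop_apply (b i j) (f' (\<gamma>' s)))" for s i j
  \<comment> \<open>The column of the \<open>Y s\<close> acts first, on the second index of \<xi>
    only; the row of the \<open>X s\<close> then acts on the first index of the result. So the two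
    estimates apply one after the other.\<close>
  define z where "z i' s j = (\<Sum>j'<m. Y s i' j' * \<xi> j j')" for i' s j
  let ?A = "matrix_alg_norm m as" and ?B = "matrix_alg_norm m bs"
  have apply_list: "bop_apply (\<Sum>ax\<leftarrow>cs. snd ax i j *\<^sub>C fst ax) u = (\<Sum>ax\<leftarrow>cs. snd ax i j *\<^sub>C bop_apply (fst ax) u)"
    for cs :: "('c::complex_hilbert_space bop \<times> (nat \<Rightarrow> nat \<Rightarrow> complex)) list" and i j u
    by (induction cs) (simp_all add: plus_bop.rep_eq zero_bop.rep_eq scaleC_bop.rep_eq)
  have "kron_coeff ?G as bs i j i' j' = (\<Sum>s\<in>S. X s i j * Y s i' j')" for i j i' j'
  proof -
    have "X s i j * Y s i' j' = (\<Sum>ax\<leftarrow>as. \<Sum>bx\<leftarrow>bs. cinner (e (\<rho> s)) (bop_apply (fst ax) (f (\<gamma> s)))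
        * cinner (e' (\<rho>' s)) (bop_apply (fst bx) (f' (\<gamma>' s))) * (snd ax i j * snd bx i' j'))" for s
      by (simp add: X_def Y_def a_def b_def case_prod_unfold apply_list cinner_sum_list_right cinner_scaleC_right
          sum_list_product mult_ac)
    then show ?thesis
      by (simp add: kron_coeff_def case_prod_unfold sum_distrib_right flip: sum_list_sum_swap)
  qed
  then have "(\<Sum>j<m. \<Sum>j'<m. kron_coeff ?G as bs i j i' j' * \<xi> j j') = (\<Sum>j<m. \<Sum>s\<in>S. X s i j * z i' s j)" for i i'
    by (simp add: z_def sum_distrib_left sum_distrib_right sum.swap[of _ S "{..<m}"] mult.assoc)
  then have "(\<Sum>i<m. \<Sum>i'<m. (cmod (\<Sum>j<m. \<Sum>j'<m. kron_coeff ?G as bs i j i' j' * \<xi> j j'))\<^sup>2)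
      = (\<Sum>i'<m. \<Sum>i<m. (cmod (\<Sum>j<m. \<Sum>s\<in>S. X s i j * z i' s j))\<^sup>2)"
    by (simp only:) (rule sum.swap)
  also have "\<dots> \<le> (\<Sum>i'<m. card R * ?A\<^sup>2 * (\<Sum>j<m. \<Sum>s\<in>S. (cmod (z i' s j))\<^sup>2))"
    unfolding X_def matrix_alg_norm_def a_def[symmetric] by (intro sum_mono row_bound fin R f inj) simp_all
  also have "\<dots> = card R * ?A\<^sup>2 * (\<Sum>j<m. \<Sum>i'<m. \<Sum>s\<in>S. (cmod (z i' s j))\<^sup>2)"
    by (simp add: sum_distrib_left[symmetric]) (intro disjI2 sum.swap)
  also have "\<dots> \<le> card R * ?A\<^sup>2 * (\<Sum>j<m. card T * ?B\<^sup>2 * (\<Sum>j'<m. (cmod (\<xi> j j'))\<^sup>2))"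
    unfolding z_def Y_def matrix_alg_norm_def[of m bs] b_def[symmetric]
    by (intro mult_left_mono sum_mono col_bound fin T e' inj') simp_all
  also have "\<dots> = (sqrt (card R * card T) * ?A * ?B)\<^sup>2 * (\<Sum>j<m. \<Sum>j'<m. (cmod (\<xi> j j'))\<^sup>2)"
    by (simp add: power_mult_distrib sum_distrib_left[symmetric] mult_ac)
  finally show "(\<Sum>i<m. \<Sum>i'<m. (cmod (\<Sum>j<m. \<Sum>j'<m. kron_coeff ?G as bs i j i' j' * \<xi> j j'))\<^sup>2)
    \<le> (sqrt (card R * card T) * ?A * ?B)\<^sup>2 * (\<Sum>j<m. \<Sum>j'<m. (cmod (\<xi> j j'))\<^sup>2)" .
qed simp

section \<open>Numerical ranges\<close>

lemma linear_functional_iff: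
  "Vector_Spaces.linear (*\<^sub>C) (*) f \<longleftrightarrow>
    (\<forall>x y. f (x + y) = f x + f y) \<and> (\<forall>c x. f (c *\<^sub>C x) = c * (f x :: complex))"
  for f :: "'v::complex_vector \<Rightarrow> complex"
  using complex_vector.vector_space_axioms[where 'a = 'v]
  by (auto simp: Vector_Spaces.linear_iff vector_space_def module_def algebra_simps)

lemma sesquilinear_form_iff:
  "sesquilinear_form B \<longleftrightarrow>
    (\<forall>x y z. B x (y + z) = B x y + B x z) \<and> (\<forall>c x y. B x (c *\<^sub>C y) = c * B x y) \<and>
    (\<forall>x y z. B (x + y) z = B x z + B y z) \<and> (\<forall>c x y. B (c *\<^sub>C x) y = cnj c * B x y)"
  unfolding sesquilinear_form_def linear_functional_iff by blast

lemma sesquilinear_sum: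
  assumes "sesquilinear_form S"
  shows "S (sum f A) y = (\<Sum>a\<in>A. S (f a) y)" "S y (sum f A) = (\<Sum>a\<in>A. S y (f a))"
proof -
  have "S 0 y = 0"
    using assms unfolding sesquilinear_form_iff by (metis complex_cnj_zero mult_zero_left scaleC_zero_left)
  then show "S (sum f A) y = (\<Sum>a\<in>A. S (f a) y)"
    using assms by (induction A rule: infinite_finite_induct) (simp_all add: sesquilinear_form_iff)
  have "S y 0 = 0"
    using assms unfolding sesquilinear_form_iff by (metis mult_zero_left scaleC_zero_left)
  then show "S y (sum f A) = (\<Sum>a\<in>A. S y (f a))"
    using assms by (induction A rule: infinite_finite_induct) (simp_all add: sesquilinear_form_iff)
qed

lemma sesquilinear_expand:
  assumes "sesquilinear_form S"
  shows "S (a *\<^sub>C x + b *\<^sub>C y) (a *\<^sub>C x + b *\<^sub>C y)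
    = cnj a * a * S x x + cnj a * b * S x y + cnj b * a * S y x + cnj b * b * S y y"
  using assms by (simp add: sesquilinear_form_iff algebra_simps)

lemma sesquilinear_scale:
  assumes "sesquilinear_form S"
  shows "S (a *\<^sub>C x) (a *\<^sub>C x) = cnj a * a * S x x"
  using assms by (simp add: sesquilinear_form_iff)

text \<open>\<open>Im (cnj z * v) = - Im (z * cnj v)\<close>, so the condition says that
  \<open>z * (u - cnj v)\<close> is real.\<close>

lemma phase_real:
  obtains z :: complex where "cmod z = 1" "Im (z * u + cnj z * v) = 0"
proof
  define w where "w = u - cnj v"
  define z where "z = (if w = 0 then 1 else cnj w / complex_of_real (cmod w))"
  show "cmod z = 1"
    by (simp add: z_def norm_divide)
  have "z * w = complex_of_real (cmod w)"
    using complex_norm_square[of w] by (simp add: z_def power2_eq_square divide_simps mult.commute)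
  moreover have "Im (z * u + cnj z * v) = Im (z * w)"
    by (simp add: w_def algebra_simps)
  ultimately show "Im (z * u + cnj z * v) = 0"
    by simp
qed

text \<open>The Toeplitz--Hausdorff theorem: after rotating one of the two vectors, the affinely normalized form
  takes real values along the segment between them, and the intermediate value theorem applies.\<close>

lemma numerical_range_convex:
  fixes S P :: "'v::complex_vector \<Rightarrow> 'v \<Rightarrow> complex"
  assumes S: "sesquilinear_form S" and P: "sesquilinear_form P" "positive_form P"
    and V: "\<And>x y. x \<in> V \<Longrightarrow> y \<in> V \<Longrightarrow> x + y \<in> V" "\<And>c x. x \<in> V \<Longrightarrow> c *\<^sub>C x \<in> V"
    and def: "\<And>x. x \<in> V \<Longrightarrow> P x x = 0 \<Longrightarrow> x = 0"
  shows "convex {z. \<exists>x\<in>V. x \<noteq> 0 \<and> S x x = z * P x x}"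
proof (rule convexI)
  fix \<alpha> \<beta> :: complex and s t :: real
  assume "\<alpha> \<in> {z. \<exists>x\<in>V. x \<noteq> 0 \<and> S x x = z * P x x}" "\<beta> \<in> {z. \<exists>x\<in>V. x \<noteq> 0 \<and> S x x = z * P x x}"
    and st: "0 \<le> s" "0 \<le> t" "s + t = 1"
  then obtain x y where x: "x \<in> V" "x \<noteq> 0" "S x x = \<alpha> * P x x" and y: "y \<in> V" "y \<noteq> 0" "S y y = \<beta> * P y y"
    by blast
  show "s *\<^sub>R \<alpha> + t *\<^sub>R \<beta> \<in> {z. \<exists>x\<in>V. x \<noteq> 0 \<and> S x x = z * P x x}"
  proof (cases "\<alpha> = \<beta>")
    case True
    then have "s *\<^sub>R \<alpha> + t *\<^sub>R \<beta> = (s + t) *\<^sub>R \<alpha>"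
      by (simp only: scaleR_add_left True)
    then have "s *\<^sub>R \<alpha> + t *\<^sub>R \<beta> = \<alpha>"
      by (simp only: st(3) scaleR_one)
    with x show ?thesis
      by auto
  next
    case False
    \<comment> \<open>Affine normalization: relative to \<open>P\<close>, the form \<open>R\<close>
      takes the value 0 at \<open>x\<close> and 1 at \<open>y\<close>, so the target value becomes
      the real number \<open>t\<close>.\<close>
    define R where "R u v = (S u v - \<alpha> * P u v) / (\<beta> - \<alpha>)" for u v
    have R: "sesquilinear_form R"
      using S P(1)
      by (simp add: R_def sesquilinear_form_iff add_divide_distrib diff_divide_distrib algebra_simps)
    have Rx: "R x x = 0" and Ry: "R y y = P y y"
      using x y False by (simp_all add: R_def field_simps)
    obtain z where z: "cmod z = 1" "Im (z * R x y + cnj z * R y x) = 0"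
      using phase_real by blast
    define w where "w r = complex_of_real (1 - r) *\<^sub>C x + (complex_of_real r * z) *\<^sub>C y" for r
    have zz: "cnj z * z = 1"
      using complex_norm_square[of z] z by (simp add: mult.commute)
    have Rw: "R (w r) (w r) = of_real (r * (1 - r)) * (z * R x y + cnj z * R y x) + of_real (r\<^sup>2) * P y y" for r
    proof -
      have "R (w r) (w r) = of_real (r * (1 - r)) * (z * R x y + cnj z * R y x) + of_real (r\<^sup>2) * (cnj z * z) * P y y"
        unfolding w_def sesquilinear_expand[OF R] Rx Ry by (simp add: algebra_simps power2_eq_square)
      then show ?thesis
        by (simp add: zz)
    qed
    have Pw: "P (w r) (w r) = of_real ((1 - r)\<^sup>2) * P x x + of_real (r * (1 - r)) * (z * P x y + cnj z * P y x)
        + of_real (r\<^sup>2) * P y y" for r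
    proof -
      have "P (w r) (w r) = of_real ((1 - r)\<^sup>2) * P x x + of_real (r * (1 - r)) * (z * P x y + cnj z * P y x)
          + of_real (r\<^sup>2) * (cnj z * z) * P y y"
        unfolding w_def sesquilinear_expand[OF P(1)] by (simp add: algebra_simps power2_eq_square)
      then show ?thesis
        by (simp add: zz)
    qed
    have ImP: "Im (P u u) = 0" "0 \<le> Re (P u u)" for u
      using P(2) by (auto simp: positive_form_def complex_is_Real_iff)
    \<comment> \<open>At a zero of \<open>h\<close> the real parts of \<open>R\<close> and of
      \<open>t\<close> times \<open>P\<close> agree. Positivity of \<open>P\<close> gives the signs
      at the end points.\<close>
    define h where "h r = Re (R (w r) (w r)) - t * Re (P (w r) (w r))" for r
    have "continuous_on {0..1} h"
      unfolding h_def Rw Pw by (intro continuous_intros)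
    moreover have "h 0 \<le> 0"
      using st ImP by (simp add: h_def Rw Pw)
    moreover have "0 \<le> h 1"
    proof -
      have "h 1 = (1 - t) * Re (P y y)"
        by (simp add: h_def Rw Pw algebra_simps)
      then show ?thesis
        using st ImP(2)[of y] by simp
    qed
    ultimately obtain r where r: "h r = 0"
      using IVT'[of h 0 0 1] by auto
    have "Im (R (w r) (w r)) = 0"
      unfolding Rw using z(2) ImP by (simp del: of_real_mult of_real_power add: Im_complex_of_real)
    then have "R (w r) (w r) = of_real t * P (w r) (w r)"
      using r ImP by (simp add: complex_eq_iff h_def)
    then have "S (w r) (w r) = (\<alpha> + of_real t * (\<beta> - \<alpha>)) * P (w r) (w r)"
      using False by (simp add: R_def field_simps)
    also have "\<alpha> + of_real t * (\<beta> - \<alpha>) = s *\<^sub>R \<alpha> + t *\<^sub>R \<beta>"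
    proof -
      have s: "s = 1 - t"
        using st by simp
      show ?thesis
        unfolding s by (simp add: scaleR_conv_of_real algebra_simps)
    qed
    finally have Sw: "S (w r) (w r) = (s *\<^sub>R \<alpha> + t *\<^sub>R \<beta>) * P (w r) (w r)" .
    have "w r \<noteq> 0"
    proof
      assume w0: "w r = 0"
      show False
      proof (cases "r = 1")
        case True
        with w0 have "z *\<^sub>C y = 0"
          by (simp add: w_def)
        then have "inverse z *\<^sub>C z *\<^sub>C y = 0"
          by simp
        moreover have "z \<noteq> 0"
          using z by auto
        ultimately show False
          using y by (simp add: scaleC_scaleC scaleC_one)
      next
        case r1: False
        define a where "a = complex_of_real (1 - r)"
        have a: "a \<noteq> 0"
          using r1 by (simp add: a_def)
        have "a *\<^sub>C x = (- (complex_of_real r * z)) *\<^sub>C y"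
          using w0 by (simp add: w_def a_def eq_neg_iff_add_eq_0 complex_vector.scale_minus_left)
        then have "inverse a *\<^sub>C a *\<^sub>C x = inverse a *\<^sub>C (- (complex_of_real r * z)) *\<^sub>C y"
          by simp
        then have "x = (inverse a * - (complex_of_real r * z)) *\<^sub>C y"
          by (simp only: scaleC_scaleC scaleC_one left_inverse[OF a])
        then obtain \<kappa> where \<kappa>: "x = \<kappa> *\<^sub>C y"
          by blast
        \<comment> \<open>Proportional vectors have the same value of \<open>S\<close> relative to
          \<open>P\<close>, which contradicts the case assumption since
          \<open>P x x \<noteq> 0\<close> by \<open>def\<close>.\<close>
        have "\<alpha> * P x x = \<beta> * P x x"
          unfolding x(3)[symmetric] by (simp add: \<kappa> sesquilinear_scale[OF S] sesquilinear_scale[OF P(1)] y(3))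
        with False x def show False
          by auto
      qed
    qed
    moreover have "w r \<in> V"
      unfolding w_def by (intro V x y)
    ultimately show ?thesis
      using Sw by blast
  qed
qed

text \<open>The average of the normalized values at the \<open>x i\<close> is attained at a single
  vector \<open>v\<close>, and there the majorization is applied. The factor \<open>c\<close> is 1
  for a single form and a weight when the form is a summand of a series.\<close>

lemma trace_bound:
  fixes S P :: "'v::complex_vector \<Rightarrow> 'v \<Rightarrow> complex" and n :: nat and c \<rho> :: real
  assumes S: "sesquilinear_form S" and P: "sesquilinear_form P" "positive_form P"
    and x: "\<And>i j. i < n \<Longrightarrow> j < n \<Longrightarrow> P (x i) (x j) = of_real \<rho> * of_bool (i = j)" and \<rho>: "\<rho> > 0"
    and major: "\<And>v. c * Re (P v v) \<le> cmod (S v v)"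
  shows "c * (n * \<rho>) \<le> cmod (\<Sum>i<n. S (x i) (x i))"
proof (cases "n = 0")
  case False
  \<comment> \<open>\<open>P\<close> may be degenerate on the whole space; on the span of the
    \<open>x i\<close> it is definite, as the convexity theorem demands.\<close>
  define V where "V = range (\<lambda>a. \<Sum>i<n. a i *\<^sub>C x i)"
  let ?W = "{z. \<exists>x\<in>V. x \<noteq> 0 \<and> S x x = z * P x x}"
  have xV: "x i \<in> V" if "i < n" for i
    unfolding V_def
  proof (rule range_eqI)
    show "x i = (\<Sum>j<n. of_bool (j = i) *\<^sub>C x j)"
      using that by (simp add: if_distrib[of "\<lambda>c. c *\<^sub>C _"] of_bool_def scaleC_one cong: if_cong)
  qed
  have P_sum: "P (\<Sum>i<n. a i *\<^sub>C x i) (\<Sum>i<n. a i *\<^sub>C x i) = of_real (\<rho> * (\<Sum>i<n. (cmod (a i))\<^sup>2))" for a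
  proof -
    have "P (\<Sum>i<n. a i *\<^sub>C x i) (\<Sum>i<n. a i *\<^sub>C x i) = (\<Sum>i<n. \<Sum>j<n. cnj (a i) * (a j * P (x i) (x j)))"
      using P(1) by (simp add: sesquilinear_sum[OF P(1)] sesquilinear_form_iff)
        (subst sum.swap, simp add: sum_distrib_left mult_ac)
    also have "\<dots> = (\<Sum>i<n. \<Sum>j<n. if j = i then of_real \<rho> * (cnj (a i) * a i) else 0)"
      by (intro sum.cong) (auto simp: x)
    also have "\<dots> = of_real (\<rho> * (\<Sum>i<n. (cmod (a i))\<^sup>2))"
      by (simp add: sum_distrib_left complex_norm_square[unfolded of_real_power] mult.commute)
    finally show ?thesis .
  qed
  have "convex ?W"
  proof (rule numerical_range_convex[OF S P])
    fix u v assume "u \<in> V" "v \<in> V"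
    then obtain a b where "u = (\<Sum>i<n. a i *\<^sub>C x i)" "v = (\<Sum>i<n. b i *\<^sub>C x i)"
      by (auto simp: V_def)
    then have "u + v = (\<Sum>i<n. (a i + b i) *\<^sub>C x i)"
      by (simp add: scaleC_add_left sum.distrib)
    then show "u + v \<in> V"
      by (simp add: V_def)
  next
    fix k u assume "u \<in> V"
    then obtain a where "u = (\<Sum>i<n. a i *\<^sub>C x i)"
      by (auto simp: V_def)
    then have "k *\<^sub>C u = (\<Sum>i<n. (k * a i) *\<^sub>C x i)"
      by (simp add: complex_vector.scale_sum_right scaleC_scaleC)
    then show "k *\<^sub>C u \<in> V"
      by (simp add: V_def)
  next
    fix u assume "u \<in> V" and u0: "P u u = 0"
    then obtain a where a: "u = (\<Sum>i<n. a i *\<^sub>C x i)"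
      by (auto simp: V_def)
    have "(\<Sum>i<n. (cmod (a i))\<^sup>2) = 0"
      using u0 \<rho> unfolding a P_sum by (simp only: of_real_eq_0_iff mult_eq_0_iff) auto
    then have "a i = 0" if "i < n" for i
      using that by (simp add: sum_nonneg_eq_0_iff)
    then show "u = 0"
      by (simp add: a)
  qed
  moreover have "S (x i) (x i) / of_real \<rho> \<in> ?W" if "i < n" for i
  proof -
    have "P (x i) (x i) = of_real \<rho>"
      using x that by simp
    moreover from this have "x i \<noteq> 0"
      using sesquilinear_scale[OF P(1), of 0 "x i"] \<rho> by auto
    ultimately show ?thesis
      using xV[OF that] \<rho> by (intro CollectI bexI[of _ "x i"]) simp_all
  qed
  ultimately have "(\<Sum>i<n. (1 / n) *\<^sub>R (S (x i) (x i) / of_real \<rho>)) \<in> ?W"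
    using False by (intro convex_sum) auto
  then obtain v where v: "v \<in> V" "v \<noteq> 0" "S v v = (\<Sum>i<n. (1 / n) *\<^sub>R (S (x i) (x i) / of_real \<rho>)) * P v v"
    by blast
  obtain a where a: "v = (\<Sum>i<n. a i *\<^sub>C x i)"
    using v by (auto simp: V_def)
  define p where "p = \<rho> * (\<Sum>i<n. (cmod (a i))\<^sup>2)"
  have Pv: "P v v = of_real p"
    unfolding a p_def by (rule P_sum)
  have "p \<noteq> 0"
  proof
    assume "p = 0"
    then have "(\<Sum>i<n. (cmod (a i))\<^sup>2) = 0"
      using \<rho> by (simp add: p_def)
    then have "a i = 0" if "i < n" for i
      using that by (simp add: sum_nonneg_eq_0_iff)
    then show False
      using v(2) by (simp add: a)
  qed
  moreover have "0 \<le> p"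
    using \<rho> by (simp add: p_def sum_nonneg)
  ultimately have p: "0 < p"
    by simp
  have "(\<Sum>i<n. (1 / n) *\<^sub>R (S (x i) (x i) / of_real \<rho>)) = (\<Sum>i<n. S (x i) (x i)) / of_real (n * \<rho>)"
    by (simp add: scaleR_conv_of_real sum_divide_distrib)
  then have "cmod (S v v) = cmod (\<Sum>i<n. S (x i) (x i)) / (n * \<rho>) * p"
    using \<rho> p by (simp add: v(3) Pv norm_mult norm_divide)
  then have "c * p \<le> cmod (\<Sum>i<n. S (x i) (x i)) / (n * \<rho>) * p"
    using major[of v] by (simp add: Pv)
  then show ?thesis
    using p \<rho> False by (simp add: field_simps)
qed simp

section \<open>The forms built from matrix units of varying shape\<close>

lemma cauchy_schwarz: "cmod (cinner u v) \<le> norm u * norm (v :: 'h::complex_hilbert_space)"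
proof (cases "u = 0")
  case False
  define N where "N = complex_of_real (norm u)"
  have "norm (inverse N *\<^sub>C u) = 1"
    using False by (simp add: N_def norm_scaleC norm_inverse)
  then have "cmod (cinner (inverse N *\<^sub>C u) v) \<le> norm v"
    by (rule cmod_cinner_unit)
  then show ?thesis
    using False by (simp add: N_def cinner_scaleC_left norm_mult norm_inverse norm_divide divide_simps mult.commute)
qed simp

lift_definition rank_one :: "'h::complex_hilbert_space \<Rightarrow> 'h \<Rightarrow> 'h bop" is "\<lambda>e f x. cinner f x *\<^sub>C e"
proof (intro conjI allI)
  fix e f x :: 'h and c
  show "bounded_linear (\<lambda>x. cinner f x *\<^sub>C e)"
  proof (rule bounded_linear_intro[where K = "norm f * norm e"])
    fix x
    show "norm (cinner f x *\<^sub>C e) \<le> norm x * (norm f * norm e)"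
      using mult_right_mono[OF cauchy_schwarz[of f x] norm_ge_zero[of e]] by (simp add: norm_scaleC mult_ac)
  qed (simp_all add: cinner_add_right scaleC_add_left scaleR_scaleC cinner_scaleC_right scaleC_scaleC)
  show "cinner f (c *\<^sub>C x) *\<^sub>C e = c *\<^sub>C cinner f x *\<^sub>C e"
    by (simp add: cinner_scaleC_right scaleC_scaleC)
qed

lemma bop_sum_apply: "bop_apply (sum f A) u = (\<Sum>a\<in>A. bop_apply (f a) u)"
  by (induction A rule: infinite_finite_induct) (simp_all add: plus_bop.rep_eq zero_bop.rep_eq)

lemma cinner_to_conj: "cinner (to_conj u) (to_conj v) = cnj (cinner u v)"
  by (simp add: cinner_conjugate.rep_eq to_conj_inverse)

lemma to_conj_add: "to_conj (u + v) = to_conj u + to_conj (v :: 'h::complex_hilbert_space)"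
  by (simp add: plus_conjugate_def to_conj_inverse)

lemma to_conj_scaleC: "to_conj (c *\<^sub>C u) = cnj c *\<^sub>C to_conj (u :: 'h::complex_hilbert_space)"
  by (simp add: scaleC_conjugate_def to_conj_inverse)

lemma bop_apply_conj_op: "bop_apply (conj_op x) u = to_conj (bop_apply x (from_conj u))"
  by (simp add: conj_op.rep_eq)

text \<open>Rewrites the antilinear factor of a form as an entry functional on the conjugate
  algebra, taken between conjugated vectors, which is the shape that
  \<open>jcb_at_most_entries\<close> treats.\<close>

lemma cinner_unconj_op:
  "cnj (cinner u (bop_apply (unconj_op a) v)) = cinner (to_conj u) (bop_apply a (to_conj v))"
proof -
  have "bop_apply a (to_conj v) = to_conj (bop_apply (unconj_op a) v)"
    by (simp add: unconj_op.rep_eq from_conj_inverse)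
  then show ?thesis
    by (simp add: cinner_to_conj)
qed

lemma orthonormal_to_conj: "orthonormal e I \<Longrightarrow> orthonormal (\<lambda>i. to_conj (e i)) I"
  by (simp add: orthonormal_def cinner_to_conj)

text \<open>Schur's test for the matrix that counts, at position \<open>(r, t)\<close>, the
  \<open>s\<close> with \<open>\<alpha> s = r\<close> and \<open>\<beta> s = t\<close>: its row sums
  are at most \<open>q\<close>, its column sums at most \<open>p\<close>.\<close>

lemma schur_test:
  fixes \<omega> :: "'t \<Rightarrow> complex" and p q :: real
  assumes fin: "finite S" "finite R" "finite T" and \<alpha>: "\<alpha> ` S \<subseteq> R" and \<beta>: "\<beta> ` S \<subseteq> T"
    and q: "\<And>r. card {s\<in>S. \<alpha> s = r} \<le> q" and p: "\<And>t. card {s\<in>S. \<beta> s = t} \<le> p" and "0 \<le> q"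
  shows "(\<Sum>r\<in>R. (cmod (\<Sum>s | s \<in> S \<and> \<alpha> s = r. \<omega> (\<beta> s)))\<^sup>2) \<le> p * q * (\<Sum>t\<in>T. (cmod (\<omega> t))\<^sup>2)"
proof -
  have "(\<Sum>r\<in>R. (cmod (\<Sum>s | s \<in> S \<and> \<alpha> s = r. \<omega> (\<beta> s)))\<^sup>2)
      \<le> (\<Sum>r\<in>R. q * (\<Sum>s | s \<in> S \<and> \<alpha> s = r. (cmod (\<omega> (\<beta> s)))\<^sup>2))"
    by (intro sum_mono order_trans[OF cmod_sum_squared_le] mult_right_mono q sum_nonneg) simp
  also have "\<dots> = q * (\<Sum>s\<in>S. (cmod (\<omega> (\<beta> s)))\<^sup>2)"
    by (simp add: sum_distrib_left[symmetric] sum.group[OF fin(1,2) \<alpha>])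
  also have "(\<Sum>s\<in>S. (cmod (\<omega> (\<beta> s)))\<^sup>2) = (\<Sum>t\<in>T. card {s\<in>S. \<beta> s = t} * (cmod (\<omega> t))\<^sup>2)"
    by (subst sum.group[OF fin(1,3) \<beta>, symmetric]) (simp add: Collect_conj_eq)
  also have "q * \<dots> \<le> q * (\<Sum>t\<in>T. p * (cmod (\<omega> t))\<^sup>2)"
    by (intro mult_left_mono sum_mono mult_right_mono p \<open>0 \<le> q\<close>) simp
  finally show ?thesis
    by (simp add: sum_distrib_left mult_ac)
qed

lemma inj_mod_div: "inj_on (\<lambda>i. (i mod m, i div m)) (A :: nat set)"
  by (rule inj_onI) (metis mod_mult_div_eq prod.inject)

lemma sum_dyadic_decay: "(\<Sum>l\<le>L. if l \<le> k then 2 ^ l / 2 ^ k else 2 ^ k / 2 ^ l :: real) \<le> 4"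
proof -
  \<comment> \<open>The bound depending on \<open>L\<close> is made for the induction: geometric
    growth up to \<open>k\<close>, and beyond it a gap to 4 of twice the last term, which leaves
    room for the whole tail.\<close>
  have "(\<Sum>l\<le>L. if l \<le> k then 2 ^ l / 2 ^ k else 2 ^ k / 2 ^ l :: real)
      \<le> (if L \<le> k then 2 * 2 ^ L / 2 ^ k else 4 - 2 * 2 ^ k / 2 ^ L)"
  proof (induction L)
    case (Suc L)
    consider "Suc L \<le> k" | "L = k" | "k < L"
      by linarith
    then show ?case
    proof cases
      case 3
      define d where "d = (2 ^ k / 2 ^ L :: real)"
      have "0 \<le> d" "2 ^ k / 2 ^ Suc L = d / 2" "2 * 2 ^ k / 2 ^ Suc L = d" "2 * 2 ^ k / 2 ^ L = 2 * d"
        by (simp_all add: d_def)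
      then show ?thesis
        using Suc 3 by (simp del: power_Suc)
    qed (use Suc in \<open>auto simp: divide_simps\<close>)
  qed (simp add: divide_right_mono)
  also have "\<dots> \<le> 4"
  proof (cases "L \<le> k")
    case True
    then have "(2::real) ^ L \<le> 2 ^ k"
      by (intro power_increasing) auto
    then have "2 * 2 ^ L \<le> (4::real) * 2 ^ k"
      using zero_le_power[of "2::real" k] by linarith
    then show ?thesis
      by (simp only: True if_True pos_divide_le_eq[OF zero_less_power[OF zero_less_numeral]])
  qed simp
  finally show ?thesis .
qed

text \<open>For \<open>i < n\<close>, level \<open>j\<close> places the matrix unit with row index \<open>i mod 4\<^sup>j\<close> and column index
  \<open>i div 4\<^sup>j\<close> in a block of its own; the block has about \<open>n\<close> entries, each of them used at most once.\<close>

locale levels =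
  fixes e :: "nat \<times> nat \<Rightarrow> 'h::complex_hilbert_space" and L n :: nat
  assumes orthonormal: "orthonormal e ({..L} \<times> {..n})"
    and level_le: "4 ^ L \<le> n"
begin

text \<open>Rows and columns of level \<open>j\<close> share the vectors \<open>e (j, _)\<close>.
  The block is a square with room for all positions up to \<open>n\<close>, of which a shape of
  \<open>4 ^ j\<close> by about \<open>n / 4 ^ j\<close> is occupied.\<close>

definition row :: "nat \<Rightarrow> nat \<Rightarrow> 'h" where "row j i = e (j, i mod 4 ^ j)"
definition col :: "nat \<Rightarrow> nat \<Rightarrow> 'h" where "col j i = e (j, i div 4 ^ j)"
definition unit :: "nat \<Rightarrow> 'h bop" where "unit i = (\<Sum>j\<le>L. rank_one (row j i) (col j i))"
definition coord :: "nat \<Rightarrow> 'h bop \<Rightarrow> complex" where "coord i x = (\<Sum>j\<le>L. cinner (row j i) (bop_apply x (col j i)))"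
definition form :: "'h bop \<Rightarrow> 'h bop \<Rightarrow> complex" where "form x y = (\<Sum>i<n. cnj (coord i x) * coord i y)"

lemma n_pos: "0 < n"
  using level_le by (metis gr0I le_zero_eq power_eq_0_iff zero_neq_numeral)

lemma power_le: "j \<le> L \<Longrightarrow> 4 ^ j \<le> n"
  using level_le power_increasing[of j L "4::nat"] by linarith

lemma row_index: "j \<le> L \<Longrightarrow> i < n \<Longrightarrow> (j, i mod 4 ^ j) \<in> {..L} \<times> {..n}"
  using mod_less_eq_dividend[of i "4 ^ j"] by (simp del: mod_less_eq_dividend)

lemma col_index: "j \<le> L \<Longrightarrow> i < n \<Longrightarrow> (j, i div 4 ^ j) \<in> {..L} \<times> {..n}"
  using div_le_dividend[of i "4 ^ j"] by (simp del: div_le_dividend)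

lemma cinner_e: "p \<in> {..L} \<times> {..n} \<Longrightarrow> q \<in> {..L} \<times> {..n} \<Longrightarrow> cinner (e p) (e q) = of_bool (p = q)"
  by (rule orthonormal_cinner[OF orthonormal])

lemma bop_apply_unit: "bop_apply (unit i) u = (\<Sum>j\<le>L. cinner (col j i) u *\<^sub>C row j i)"
  by (simp add: unit_def bop_sum_apply rank_one.rep_eq)

text \<open>The blocks are mutually orthogonal, so testing against a vector of level
  \<open>l\<close> leaves at most one summand of \<open>unit i\<close>.\<close>

lemma cinner_unit:
  assumes "l \<le> L" "a \<le> n" "i < n"
  shows "cinner (e (l, a)) (bop_apply (unit i) u) = (if i mod 4 ^ l = a then cinner (col l i) u else 0)"
proof -
  have "cinner (e (l, a)) (bop_apply (unit i) u)
      = (\<Sum>j\<le>L. if j = l then if i mod 4 ^ l = a then cinner (col l i) u else 0 else 0)"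
    unfolding bop_apply_unit cinner_sum_right cinner_scaleC_right
    using assms row_index by (intro sum.cong) (auto simp: row_def cinner_e)
  then show ?thesis
    using assms by simp
qed

text \<open>Quotient and remainder determine the index, so distinct units occupy distinct positions
  in every level, and the \<open>L + 1\<close> levels add up coherently.\<close>

lemma coord_unit:
  assumes "i < n" "i' < n"
  shows "coord i (unit i') = of_nat (Suc L) * of_bool (i = i')"
proof -
  have "cinner (row j i) (bop_apply (unit i') (col j i)) = of_bool (i = i')" if "j \<le> L" for j
  proof -
    have "cinner (row j i) (bop_apply (unit i') (col j i))
        = of_bool (i mod 4 ^ j = i' mod 4 ^ j \<and> i div 4 ^ j = i' div 4 ^ j)"
      using row_index[of j i] that assms col_index[OF that]
      by (auto simp: row_def cinner_unit col_def cinner_e)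
    also have "(i mod 4 ^ j = i' mod 4 ^ j \<and> i div 4 ^ j = i' div 4 ^ j) \<longleftrightarrow> i = i'"
      by (metis mod_mult_div_eq)
    finally show ?thesis .
  qed
  then show ?thesis
    by (simp add: coord_def)
qed

lemma coord_add: "coord i (x + y) = coord i x + coord i y"
  by (simp add: coord_def plus_bop.rep_eq cinner_add_right sum.distrib)

lemma coord_scaleC: "coord i (c *\<^sub>C x) = c * coord i x"
  by (simp add: coord_def scaleC_bop.rep_eq cinner_scaleC_right sum_distrib_left)

lemma coord_sum: "coord i (sum f A) = (\<Sum>a\<in>A. coord i (f a))"
proof -
  have "coord i 0 = 0"
    using coord_scaleC[of i 0 0] by simp
  then show ?thesis
    by (induction A rule: infinite_finite_induct) (simp_all add: coord_add)
qed

lemma sesquilinear_form: "sesquilinear_form form"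
  unfolding sesquilinear_form_iff
  by (simp add: form_def coord_add coord_scaleC algebra_simps sum.distrib sum_distrib_left)

lemma form_self: "form x x = of_real (\<Sum>i<n. (cmod (coord i x))\<^sup>2)"
  by (simp add: form_def complex_norm_square[unfolded of_real_power] mult.commute)

lemma positive_form: "positive_form form"
  by (simp add: positive_form_def form_self sum_nonneg del: of_real_sum)

lemma form_unit:
  assumes "i < n" "j < n"
  shows "form (unit i) (unit j) = of_real ((real (Suc L))\<^sup>2) * of_bool (i = j)"
proof -
  have "form (unit i) (unit j)
      = (\<Sum>k<n. if k = i then of_nat (Suc L) * of_nat (Suc L) * of_bool (i = j) else 0)"
    unfolding form_def using assms by (intro sum.cong) (auto simp: coord_unit)
  then show ?thesis
    using assms by (simp add: power2_eq_square)
qed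

lemma form_rank: "form_rank form n"
  unfolding form_rank_def quotient_dim_def
proof (intro exI[of _ "unit ` {..<n}"] conjI allI impI ballI)
  have L0: "(1 + of_nat L :: complex) \<noteq> 0"
    by (metis of_nat_Suc of_nat_neq_0)
  have inj: "inj_on unit {..<n}"
  proof (rule inj_onI)
    fix i j assume ij: "i \<in> {..<n}" "j \<in> {..<n}" "unit i = unit j"
    then have "coord i (unit j) = of_nat (Suc L)"
      using coord_unit[of i i] by simp
    then show "i = j"
      using coord_unit[of i j] ij L0 by (auto simp: of_bool_def split: if_splits)
  qed
  show "finite (unit ` {..<n})" "card (unit ` {..<n}) = n"
    using inj by (simp_all add: card_image)
  have zero: "form x x = 0 \<longleftrightarrow> (\<forall>i<n. coord i x = 0)" for x
    unfolding form_self of_real_eq_0_iff by (auto simp: sum_nonneg_eq_0_iff)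
  have sum_unit: "coord i (\<Sum>x\<in>unit ` {..<n}. c x *\<^sub>C x) = of_nat (Suc L) * c (unit i)" if "i < n" for c i
  proof -
    have "coord i (\<Sum>x\<in>unit ` {..<n}. c x *\<^sub>C x) = (\<Sum>j<n. if j = i then c (unit i) * of_nat (Suc L) else 0)"
      unfolding sum.reindex[OF inj] coord_sum
      using that by (intro sum.cong) (auto simp: coord_scaleC coord_unit)
    then show ?thesis
      using that by (simp add: mult.commute)
  qed
  show "c x = 0" if "(\<Sum>x\<in>unit ` {..<n}. c x *\<^sub>C x) \<in> {x. form x x = 0}" "x \<in> unit ` {..<n}" for c x
    using that L0 by (auto simp: zero sum_unit)
  show "\<exists>c. x - (\<Sum>x\<in>unit ` {..<n}. c x *\<^sub>C x) \<in> {x. form x x = 0}" for x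
  proof (intro exI CollectI)
    \<comment> \<open>By \<open>coord_unit\<close> the functionals \<open>coord i\<close>, divided
      by \<open>L + 1\<close>, are dual to the units and so yield the coefficients of the class of
      \<open>x\<close>.\<close>
    let ?c = "\<lambda>u. coord (the_inv_into {..<n} unit u) x / of_nat (Suc L)"
    have "coord i (x - (\<Sum>x\<in>unit ` {..<n}. ?c x *\<^sub>C x)) = 0" if "i < n" for i
    proof -
      have "coord i x = coord i (x - (\<Sum>x\<in>unit ` {..<n}. ?c x *\<^sub>C x)) + coord i (\<Sum>x\<in>unit ` {..<n}. ?c x *\<^sub>C x)"
        by (simp flip: coord_add)
      also have "coord i (\<Sum>x\<in>unit ` {..<n}. ?c x *\<^sub>C x) = coord i x"
        using that L0 by (simp add: sum_unit the_inv_into_f_f[OF inj])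
      finally show ?thesis
        by simp
    qed
    then show "form (x - (\<Sum>x\<in>unit ` {..<n}. ?c x *\<^sub>C x)) (x - (\<Sum>x\<in>unit ` {..<n}. ?c x *\<^sub>C x)) = 0"
      by (simp add: zero)
  qed
qed

section \<open>The jcb norm of the form\<close>

lemma bilinear_of_form:
  "bilinear_of form = (\<lambda>a b. \<Sum>k\<le>L. \<Sum>l\<le>L. \<Sum>i<n.
     cinner (to_conj (row k i)) (bop_apply a (to_conj (col k i))) * cinner (row l i) (bop_apply b (col l i)))"
proof (intro ext)
  fix a b
  have "bilinear_of form a b = (\<Sum>i<n. \<Sum>k\<le>L. \<Sum>l\<le>L.
      cinner (to_conj (row k i)) (bop_apply a (to_conj (col k i))) * cinner (row l i) (bop_apply b (col l i)))"
    by (simp add: bilinear_of_def form_def coord_def cinner_unconj_op sum_product)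
  then show "bilinear_of form a b = (\<Sum>k\<le>L. \<Sum>l\<le>L. \<Sum>i<n.
      cinner (to_conj (row k i)) (bop_apply a (to_conj (col k i))) * cinner (row l i) (bop_apply b (col l i)))"
    by (simp add: sum.swap[of _ _ "{..<n}"])
qed

text \<open>At most \<open>(n - 1) div 4 ^ l + 1\<close> columns occur; the extra one is absorbed by
  \<open>4 ^ l \<le> n\<close>, whence the factor 2.\<close>

lemma card_col_image: "l \<le> L \<Longrightarrow> 4 ^ l * card ((\<lambda>i. i div 4 ^ l) ` {..<n}) \<le> 2 * n"
proof -
  assume l: "l \<le> L"
  have "(\<lambda>i. i div 4 ^ l) ` {..<n} \<subseteq> {..(n - 1) div 4 ^ l}"
    using div_le_mono by fastforce
  then have "card ((\<lambda>i. i div 4 ^ l) ` {..<n}) \<le> Suc ((n - 1) div 4 ^ l)"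
    using card_mono[of "{..(n - 1) div 4 ^ l}"] by simp
  then have "4 ^ l * card ((\<lambda>i. i div 4 ^ l) ` {..<n}) \<le> 4 ^ l * Suc ((n - 1) div 4 ^ l)"
    by (rule mult_le_mono2)
  also have "\<dots> = 4 ^ l + 4 ^ l * ((n - 1) div 4 ^ l)"
    by simp
  also have "\<dots> \<le> n + n"
    by (intro add_mono power_le l order_trans[OF times_div_less_eq_dividend]) simp
  finally show ?thesis
    by simp
qed

text \<open>The right side decays only for \<open>k \<le> l\<close>, so rows have to be counted at
  the lower of the two levels.\<close>

lemma sqrt_row_col_le:
  assumes "k \<le> L" "l \<le> L"
  shows "sqrt (real (card {..<4 ^ k :: nat}) * real (card ((\<lambda>i. i div 4 ^ l) ` {..<n}))) \<le> sqrt (2 * n) * (2 ^ k / 2 ^ l)"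
proof -
  have "real (4 ^ l * card ((\<lambda>i. i div 4 ^ l) ` {..<n})) \<le> real (2 * n)"
    using card_col_image[OF assms(2)] by (simp only: of_nat_le_iff)
  then have "real (card ((\<lambda>i. i div 4 ^ l) ` {..<n})) \<le> 2 * n / 4 ^ l"
    by (simp add: field_simps)
  then have "4 ^ k * real (card ((\<lambda>i. i div 4 ^ l) ` {..<n})) \<le> 4 ^ k * (2 * n / 4 ^ l)"
    by (rule mult_left_mono) simp
  also have "\<dots> = 2 * n * (2 ^ k / 2 ^ l)\<^sup>2"
    by (simp add: power_divide flip: power_mult) (simp add: power_mult mult.commute[of _ 2])
  finally have "sqrt (4 ^ k * real (card ((\<lambda>i. i div 4 ^ l) ` {..<n}))) \<le> sqrt (2 * n * (2 ^ k / 2 ^ l)\<^sup>2)"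
    by (rule real_sqrt_le_mono)
  then show ?thesis
    by (simp add: real_sqrt_mult)
qed

lemma jcb_at_most_form: "jcb_at_most (4 * sqrt (2 * n) * Suc L) (bilinear_of form)"
proof -
  define G where "G k l a b = (\<Sum>i<n. cinner (to_conj (row k i)) (bop_apply a (to_conj (col k i)))
      * cinner (row l i) (bop_apply b (col l i)))" for k l a b
  define D where "D k l = (if l \<le> k then 2 ^ l / 2 ^ k else 2 ^ k / 2 ^ l :: real)" for k l :: nat
  let ?c = "to_conj :: 'h \<Rightarrow> 'h conjugate"
  have norm: "norm (e (j, a)) = 1" "norm (?c (e (j, a))) = 1" if "j \<le> L" "a \<le> n" for j a
    using that orthonormal_norm[OF orthonormal] orthonormal_norm[OF orthonormal_to_conj[OF orthonormal]] by auto
  have on: "orthonormal (\<lambda>a. e (j, a)) A" "orthonormal (\<lambda>a. ?c (e (j, a))) A" if "j \<le> L" "A \<subseteq> {..n}" for j A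
    using that by (auto simp: orthonormal_def cinner_to_conj cinner_e subset_iff)
  have div_le: "i div 4 ^ j \<le> n" and mod_le: "i mod 4 ^ j \<le> n" if "i < n" for i j
    using that div_le_dividend[of i "4 ^ j"] mod_less_eq_dividend[of i "4 ^ j"] by linarith+
  have lt_le: "a \<le> n" if "a < 4 ^ j" "j \<le> L" for a j
    using that power_le[of j] by linarith
  have G: "jcb_at_most (sqrt (2 * n) * D k l) (G k l)" if kl: "k \<le> L" "l \<le> L" for k l
  proof (cases "l \<le> k")
    \<comment> \<open>The lower level \<open>l\<close> supplies the rows and \<open>k\<close> the
      columns. Level \<open>l\<close> belongs to the second factor, so the estimate is proved with
      the factors exchanged.\<close>
    case True
    have "jcb_at_most (sqrt (card {..<4 ^ l :: nat} * card ((\<lambda>i. i div 4 ^ k) ` {..<n})))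
      (\<lambda>b a. \<Sum>i<n. cinner (e (l, i mod 4 ^ l)) (bop_apply b (e (l, i div 4 ^ l)))
        * cinner (?c (e (k, i mod 4 ^ k))) (bop_apply a (?c (e (k, i div 4 ^ k)))))"
      using kl by (intro jcb_at_most_entries norm on inj_mod_div) (auto simp: lt_le div_le mod_le)
    then have "jcb_at_most (sqrt (card {..<4 ^ l :: nat} * card ((\<lambda>i. i div 4 ^ k) ` {..<n}))) (\<lambda>b a. G k l a b)"
      by (simp add: G_def row_def col_def mult.commute)
    then have "jcb_at_most (sqrt (card {..<4 ^ l :: nat} * card ((\<lambda>i. i div 4 ^ k) ` {..<n}))) (G k l)"
      by (rule jcb_at_most_swap[rotated]) simp
    then show ?thesis
      by (rule jcb_at_most_mono) (use True sqrt_row_col_le[OF kl(2,1)] in \<open>simp add: D_def\<close>)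
  next
    case False
    have "jcb_at_most (sqrt (card {..<4 ^ k :: nat} * card ((\<lambda>i. i div 4 ^ l) ` {..<n})))
      (\<lambda>a b. \<Sum>i<n. cinner (?c (e (k, i mod 4 ^ k))) (bop_apply a (?c (e (k, i div 4 ^ k))))
        * cinner (e (l, i mod 4 ^ l)) (bop_apply b (e (l, i div 4 ^ l))))"
      using kl by (intro jcb_at_most_entries norm on inj_mod_div) (auto simp: lt_le div_le mod_le)
    moreover have "G k l = (\<lambda>a b. \<Sum>i<n. cinner (?c (e (k, i mod 4 ^ k))) (bop_apply a (?c (e (k, i div 4 ^ k))))
        * cinner (e (l, i mod 4 ^ l)) (bop_apply b (e (l, i div 4 ^ l))))"
      by (intro ext) (simp add: G_def row_def col_def)
    ultimately have "jcb_at_most (sqrt (card {..<4 ^ k :: nat} * card ((\<lambda>i. i div 4 ^ l) ` {..<n}))) (G k l)"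
      by simp
    then show ?thesis
      by (rule jcb_at_most_mono) (use False sqrt_row_col_le[OF kl] in \<open>simp add: D_def\<close>)
  qed
  have "jcb_at_most (\<Sum>k\<le>L. \<Sum>l\<le>L. sqrt (2 * n) * D k l) (\<lambda>a b. \<Sum>k\<le>L. \<Sum>l\<le>L. G k l a b)"
    by (intro jcb_at_most_sum G) auto
  \<comment> \<open>For each \<open>k\<close> the sum over \<open>l\<close> costs only the constant
    4, so one factor \<open>L + 1\<close> appears instead of two.\<close>
  moreover have "(\<Sum>k\<le>L. \<Sum>l\<le>L. sqrt (2 * n) * D k l) \<le> (\<Sum>k\<le>L. sqrt (2 * n) * 4)"
    unfolding sum_distrib_left[symmetric] D_def by (intro mult_left_mono sum_mono sum_dyadic_decay) simp
  ultimately show ?thesis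
    unfolding bilinear_of_form G_def[symmetric] by (elim jcb_at_most_mono) (simp add: mult_ac)
qed

section \<open>Integrality of the form and the bound for its majorants\<close>

lemma integral_form: "integral_form (bilinear_of form)"
proof -
  have norm: "norm (row j i) = 1" "norm (col j i) = 1" if "j \<le> L" "i < n" for j i
    unfolding row_def col_def
    using orthonormal_norm[OF orthonormal] row_index[OF that] col_index[OF that] by blast+
  have norm_to_conj: "norm (to_conj u) = norm u" for u :: 'h
    by (simp add: norm_conjugate.rep_eq to_conj_inverse)
  \<comment> \<open>Only finiteness matters here, so each of the \<open>(Suc L)\<^sup>2 * n\<close>
    products of entry functionals is estimated separately.\<close>
  have "cmod (\<Sum>(x, y)\<leftarrow>ts. bilinear_of form x y) \<le> real ((Suc L)\<^sup>2 * n) * min_tensor_norm ts" for ts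
  proof -
    have "(\<Sum>(x, y)\<leftarrow>ts. bilinear_of form x y) = (\<Sum>k\<le>L. \<Sum>l\<le>L. \<Sum>i<n. \<Sum>(x, y)\<leftarrow>ts.
        cinner (to_conj (row k i)) (bop_apply x (to_conj (col k i))) * cinner (row l i) (bop_apply y (col l i)))"
      by (simp add: bilinear_of_form case_prod_unfold sum_list_sum_swap)
    also have "cmod \<dots> \<le> (\<Sum>k\<le>L. \<Sum>l\<le>L. \<Sum>i<n. min_tensor_norm ts)"
      by (intro sum_norm_le cmod_entry_sum_le) (auto simp: norm norm_to_conj)
    finally show ?thesis
      by (simp add: power2_eq_square algebra_simps)
  qed
  then have "real ((Suc L)\<^sup>2 * n) \<in> integral_bounds (bilinear_of form)"
    using n_pos by (simp add: integral_bounds_def)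
  then show ?thesis
    unfolding integral_form_def bilinear_form_bilinear_of using sesquilinear_form by blast
qed

text \<open>The operator is the orthogonal sum of its parts on the pairs \<open>(k, l)\<close> of
  levels, and each part is a matrix of nonnegative integers. Fixing \<open>i mod 4 ^ k\<close>
  leaves at most as many \<open>i\<close> as level \<open>k\<close> has columns, fixing
  \<open>i div 4 ^ k\<close> leaves at most \<open>4 ^ k\<close>. The product is at most
  \<open>2 * n\<close> for every pair, and orthogonality keeps the number of pairs out of the
  bound.\<close>

lemma min_tensor_norm_units:
  "min_tensor_norm (map (\<lambda>i. (conj_op (unit i), unit i)) [0..<n]) \<le> sqrt (2 * n)"
proof (rule min_tensor_norm_le)
  fix us :: "('h conjugate \<times> 'h) list"
  let ?ts = "map (\<lambda>i. (conj_op (unit i), unit i)) [0..<n]"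
  let ?vs = "tensor_apply ?ts us"
  let ?I = "{..L} \<times> {..n}"
  let ?e = "\<lambda>p. to_conj (e p)"
  have on': "orthonormal ?e ?I"
    by (rule orthonormal_to_conj[OF orthonormal])
  \<comment> \<open>Coordinates of the input in the pair \<open>(k, l)\<close>. Below, \<alpha>
    gives the position to which the \<open>i\<close>-th term writes and \<beta> the one from which
    it reads.\<close>
  define \<omega> where "\<omega> k l = (\<lambda>(b, b'). tensor_coeff us (?e (k, b)) (e (l, b')))" for k l
  define \<alpha> where "\<alpha> k l i = (i mod 4 ^ k, i mod 4 ^ l)" for k l i :: nat
  define \<beta> where "\<beta> k l i = (i div 4 ^ k, i div 4 ^ l)" for k l i :: nat
  have coeff: "tensor_coeff ?vs (?e (k, a)) (e (l, a'))
      = (\<Sum>i | i \<in> {..<n} \<and> \<alpha> k l i = (a, a'). \<omega> k l (\<beta> k l i))"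
    if "k \<le> L" "l \<le> L" "a \<le> n" "a' \<le> n" for k l a a'
  proof -
    have conj: "cinner (?e (k, a)) (bop_apply (conj_op (unit i)) u)
        = (if i mod 4 ^ k = a then cinner (?e (k, i div 4 ^ k)) u else 0)" if "i < n" for i u
    proof -
      have "u = to_conj (from_conj u)"
        by (simp add: from_conj_inverse)
      then show ?thesis
        using cinner_unit[OF \<open>k \<le> L\<close> \<open>a \<le> n\<close> that, of "from_conj u"]
        by (metis bop_apply_conj_op cinner_to_conj col_def complex_cnj_zero)
    qed
    have "tensor_coeff ?vs (?e (k, a)) (e (l, a'))
        = (\<Sum>i\<leftarrow>[0..<n]. \<Sum>(u, v)\<leftarrow>us. cinner (?e (k, a)) (bop_apply (conj_op (unit i)) u)
            * cinner (e (l, a')) (bop_apply (unit i) v))"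
      by (simp add: tensor_coeff_tensor_apply comp_def)
    also have "\<dots> = (\<Sum>i<n. \<Sum>(u, v)\<leftarrow>us. cinner (?e (k, a)) (bop_apply (conj_op (unit i)) u)
            * cinner (e (l, a')) (bop_apply (unit i) v))"
      by (simp add: interv_sum_list_conv_sum_set_nat atLeast0LessThan)
    also have "\<dots> = (\<Sum>i<n. if \<alpha> k l i = (a, a') then \<omega> k l (\<beta> k l i) else 0)"
      using that by (intro sum.cong)
        (auto simp: conj cinner_unit \<alpha>_def \<beta>_def \<omega>_def tensor_coeff_def col_def case_prod_unfold)
    also have "\<dots> = (\<Sum>i | i \<in> {..<n} \<and> \<alpha> k l i = (a, a'). \<omega> k l (\<beta> k l i))"
      by (rule sum.inter_filter[symmetric]) simp
    finally show ?thesis .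
  qed
  have schur: "(\<Sum>(a, a')\<in>{..n} \<times> {..n}. (cmod (tensor_coeff ?vs (?e (k, a)) (e (l, a'))))\<^sup>2)
      \<le> 2 * n * (\<Sum>bb\<in>{..n} \<times> {..n}. (cmod (\<omega> k l bb))\<^sup>2)" if kl: "k \<le> L" "l \<le> L" for k l
  proof -
    have "(\<Sum>(a, a')\<in>{..n} \<times> {..n}. (cmod (tensor_coeff ?vs (?e (k, a)) (e (l, a'))))\<^sup>2)
        = (\<Sum>r\<in>{..n} \<times> {..n}. (cmod (\<Sum>i | i \<in> {..<n} \<and> \<alpha> k l i = r. \<omega> k l (\<beta> k l i)))\<^sup>2)"
      using coeff[OF kl] by (intro sum.cong) auto
    also have "\<dots> \<le> 4 ^ k * real (card ((\<lambda>i. i div 4 ^ k) ` {..<n})) * (\<Sum>bb\<in>{..n} \<times> {..n}. (cmod (\<omega> k l bb))\<^sup>2)"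
    proof (rule schur_test)
      show "\<alpha> k l ` {..<n} \<subseteq> {..n} \<times> {..n}" "\<beta> k l ` {..<n} \<subseteq> {..n} \<times> {..n}"
        unfolding \<alpha>_def \<beta>_def using row_index[OF kl(1)] row_index[OF kl(2)] col_index[OF kl(1)] col_index[OF kl(2)]
        by auto
      fix r
      have "inj_on (\<lambda>i. i div 4 ^ k) {i \<in> {..<n}. \<alpha> k l i = r}"
        unfolding \<alpha>_def by (rule inj_onI) (auto, metis mod_mult_div_eq)
      moreover have "(\<lambda>i. i div 4 ^ k) ` {i \<in> {..<n}. \<alpha> k l i = r} \<subseteq> (\<lambda>i. i div 4 ^ k) ` {..<n}"
        by blast
      ultimately show "real (card {i \<in> {..<n}. \<alpha> k l i = r}) \<le> real (card ((\<lambda>i. i div 4 ^ k) ` {..<n}))"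
        by (simp only: of_nat_le_iff) (rule card_inj_on_le, auto)
    next
      fix t
      have "inj_on (\<lambda>i. i mod 4 ^ k) {i \<in> {..<n}. \<beta> k l i = t}"
        unfolding \<beta>_def by (rule inj_onI) (auto, metis mod_mult_div_eq)
      then have "card {i \<in> {..<n}. \<beta> k l i = t} \<le> card {..<4 ^ k :: nat}"
        by (rule card_inj_on_le) auto
      then have "real (card {i \<in> {..<n}. \<beta> k l i = t}) \<le> real (4 ^ k)"
        by (simp only: of_nat_le_iff card_lessThan)
      then show "real (card {i \<in> {..<n}. \<beta> k l i = t}) \<le> 4 ^ k"
        by simp
    qed auto
    also have "\<dots> \<le> 2 * n * (\<Sum>bb\<in>{..n} \<times> {..n}. (cmod (\<omega> k l bb))\<^sup>2)"
    proof (rule mult_right_mono)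
      show "4 ^ k * real (card ((\<lambda>i. i div 4 ^ k) ` {..<n})) \<le> 2 * n"
        using of_nat_mono[OF card_col_image[OF kl(1)], where 'a = real] by simp
    qed (simp add: sum_nonneg)
    finally show ?thesis .
  qed
  have split: "(\<Sum>p\<in>?I. \<Sum>q\<in>?I. h p q) = (\<Sum>k\<le>L. \<Sum>l\<le>L. \<Sum>(a, a')\<in>{..n} \<times> {..n}. h (k, a) (l, a'))"
    for h :: "nat \<times> nat \<Rightarrow> nat \<times> nat \<Rightarrow> real"
    unfolding sum.cartesian_product' prod.case by (intro sum.cong refl sum.swap)
  \<comment> \<open>The output lies in the span of the blocks, so its norm is known exactly; the
    input is arbitrary and only Bessel's inequality is available, which is the direction
    required.\<close>
  have expands: "expands (e ` ?I) (bop_apply (unit i) v)" if "i < n" for i v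
    unfolding bop_apply_unit row_def using that row_index orthonormal_image(2)[OF orthonormal]
    by (intro expands_sum expands_scaleC expands_member) auto
  have expands': "expands (?e ` ?I) (bop_apply (conj_op (unit i)) u)" if "i < n" for i u
  proof -
    have to_conj_sum: "to_conj (\<Sum>j\<in>A. c j *\<^sub>C w j) = (\<Sum>j\<in>A. cnj (c j) *\<^sub>C to_conj (w j))" for A :: "nat set" and c and w :: "nat \<Rightarrow> 'h"
      by (induction A rule: infinite_finite_induct) (simp_all add: to_conj_add to_conj_scaleC zero_conjugate_def)
    show ?thesis
      unfolding bop_apply_conj_op bop_apply_unit row_def to_conj_sum
      using that row_index orthonormal_image(2)[OF on'] by (intro expands_sum expands_scaleC expands_member) auto
  qed
  have inj: "inj_on (map_prod ?e e) (?I \<times> ?I)"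
    by (intro map_prod_inj_on orthonormal_image(1) on' orthonormal)
  have "(hilbert_tensor_norm ?vs)\<^sup>2 = (\<Sum>(p, q)\<in>?e ` ?I \<times> e ` ?I. (cmod (tensor_coeff ?vs p q))\<^sup>2)"
  proof -
    have "hilbert_tensor_norm ?vs = L2_set (\<lambda>(p, q). cmod (tensor_coeff ?vs p q)) (?e ` ?I \<times> e ` ?I)"
      by (rule hilbert_tensor_norm_eq) (auto simp: tensor_apply_def intro!: expands expands')
    then show ?thesis
      by (simp add: L2_set_def sum_nonneg case_prod_unfold)
  qed
  also have "\<dots> = (\<Sum>(p, q)\<in>map_prod ?e e ` (?I \<times> ?I). (cmod (tensor_coeff ?vs p q))\<^sup>2)"
    by (rule sum.cong) auto
  also have "\<dots> = (\<Sum>p\<in>?I. \<Sum>q\<in>?I. (cmod (tensor_coeff ?vs (?e p) (e q)))\<^sup>2)"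
    by (subst sum.reindex[OF inj]) (simp add: case_prod_unfold sum.cartesian_product)
  also have "\<dots> \<le> (\<Sum>k\<le>L. \<Sum>l\<le>L. 2 * n * (\<Sum>bb\<in>{..n} \<times> {..n}. (cmod (\<omega> k l bb))\<^sup>2))"
    unfolding split by (intro sum_mono schur) auto
  also have "\<dots> = 2 * n * (\<Sum>p\<in>?I. \<Sum>q\<in>?I. (cmod (tensor_coeff us (?e p) (e q)))\<^sup>2)"
    unfolding split by (simp add: sum_distrib_left[symmetric] \<omega>_def case_prod_unfold)
  also have "\<dots> = 2 * n * (L2_set (\<lambda>(p, q). cmod (tensor_coeff us (?e p) (e q))) (?I \<times> ?I))\<^sup>2"
    by (simp add: L2_set_def sum_nonneg sum.cartesian_product case_prod_unfold)
  also have "\<dots> \<le> 2 * n * (hilbert_tensor_norm us)\<^sup>2"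
    by (intro mult_left_mono power_mono tensor_bessel on' orthonormal L2_set_nonneg) auto
  finally have "(hilbert_tensor_norm ?vs)\<^sup>2 \<le> (sqrt (2 * n) * hilbert_tensor_norm us)\<^sup>2"
    by (simp only: power_mult_distrib real_sqrt_pow2[OF of_nat_0_le_iff])
  then show "hilbert_tensor_norm ?vs \<le> sqrt (2 * n) * hilbert_tensor_norm us"
    by (rule power2_le_imp_le) (intro mult_nonneg_nonneg hilbert_tensor_norm_nonneg real_sqrt_ge_zero of_nat_0_le_iff)
qed simp

text \<open>\<open>B'\<close> is paired with the tensor formed by the conjugated units and the
  units. The lower estimate is the trace bound; the upper one holds for every admissible constant,
  hence for the infimum.\<close>

lemma majorant_bound:
  assumes B': "sesquilinear_form B'" "integral_form (bilinear_of B')"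
    and major: "\<And>x. c * Re (form x x) \<le> cmod (B' x x)"
  shows "c * (n * (real (Suc L))\<^sup>2) \<le> integral_norm (bilinear_of B') * sqrt (2 * n)"
proof -
  have "c * (n * (real (Suc L))\<^sup>2) \<le> cmod (\<Sum>i<n. B' (unit i) (unit i))"
    using trace_bound[OF B'(1) sesquilinear_form positive_form form_unit _ major] by simp
  also have "\<dots> \<le> Inf (integral_bounds (bilinear_of B')) * sqrt (2 * n)"
  proof (rule le_Inf_mult)
    show "integral_bounds (bilinear_of B') \<noteq> {}"
      using B'(2) by (simp add: integral_form_def)
    fix C assume C: "C \<in> integral_bounds (bilinear_of B')"
    let ?ts = "map (\<lambda>i. (conj_op (unit i), unit i)) [0..<n]"
    have "(\<Sum>i<n. B' (unit i) (unit i)) = (\<Sum>(x, y)\<leftarrow>?ts. bilinear_of B' x y)"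
      by (simp add: comp_def bilinear_of_def interv_sum_list_conv_sum_set_nat atLeast0LessThan)
    then have "cmod (\<Sum>i<n. B' (unit i) (unit i)) \<le> C * min_tensor_norm ?ts"
      using C by (simp add: integral_bounds_def del: map_map)
    also have "\<dots> \<le> C * sqrt (2 * n)"
      using C min_tensor_norm_units by (intro mult_left_mono) (auto simp: integral_bounds_def)
    finally show "cmod (\<Sum>i<n. B' (unit i) (unit i)) \<le> C * sqrt (2 * n)" .
  qed simp
  finally show ?thesis
    by (simp add: integral_norm_def)
qed

end

text \<open>Positivity bounds every weighted summand by the whole series, so a majorant of
  \<open>B\<close> majorizes each of them. The weights sum to 2, which bounds the partial sums
  uniformly and passes to the limit.\<close>

lemma jcb_series:
  fixes F :: "nat \<Rightarrow> 'h::complex_hilbert_space bop \<Rightarrow> 'h bop \<Rightarrow> complex"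
  assumes F: "\<And>m. sesquilinear_form (F m)" "\<And>m. positive_form (F m)" "\<And>m. jcb_at_most 1 (bilinear_of (F m))"
  obtains B where "sesquilinear_form B" "positive_form B" "jcb_at_most 2 (bilinear_of B)"
    "\<And>m x. (1 / 2) ^ m * Re (F m x x) \<le> Re (B x x)"
proof
  define B where "B x y = (\<Sum>m. (1 / 2) ^ m * F m x y)" for x y
  have sm: "summable (\<lambda>m. (1 / 2) ^ m * F m x y)" for x y
  proof (rule summable_comparison_test')
    let ?K = "matrix_alg_norm 1 [(conj_op x, \<lambda>_ _. 1)] * matrix_alg_norm 1 [(y, \<lambda>_ _. 1)]"
    show "summable (\<lambda>m. (1 / 2) ^ m * ?K)"
      by (intro summable_mult2 summable_geometric) simp
    fix m :: nat
    have "cmod (F m x y) \<le> ?K"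
      using jcb_at_most_cmod[OF F(3), of m "conj_op x" y] by (simp add: bilinear_of_def)
    then show "norm ((1 / 2) ^ m * F m x y) \<le> (1 / 2) ^ m * ?K"
      by (simp add: norm_mult norm_power norm_divide mult_left_mono)
  qed
  have lin: "F m x (y + z) = F m x y + F m x z" "F m x (c *\<^sub>C y) = c * F m x y"
    "F m (x + y) z = F m x z + F m y z" "F m (c *\<^sub>C x) y = cnj c * F m x y" for m x y z c
    using F(1)[of m] by (simp_all add: sesquilinear_form_iff)
  show "sesquilinear_form B"
    unfolding sesquilinear_form_iff B_def lin
    by (simp add: distrib_left suminf_add[OF sm sm] suminf_mult[OF sm] mult.left_commute[of "(1 / 2) ^ _"]
        del: power_divide)
  have Re_B: "Re (B x x) = (\<Sum>m. (1 / 2) ^ m * Re (F m x x))" "Im (B x x) = 0"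
    and sRe: "summable (\<lambda>m. (1 / 2) ^ m * Re (F m x x))" and pos: "0 \<le> Re (F m x x)" for m x
  proof -
    have eq: "(1 / 2) ^ m * F m x x = of_real ((1 / 2) ^ m * Re (F m x x))" for m
    proof -
      have "F m x x = of_real (Re (F m x x))"
        using F(2)[of m] by (simp add: positive_form_def complex_is_Real_iff complex_eq_iff)
      then show ?thesis
        by (metis of_real_1 of_real_divide of_real_mult of_real_numeral of_real_power)
    qed
    show sRe: "summable (\<lambda>m. (1 / 2) ^ m * Re (F m x x))"
      using sm[of x x] unfolding eq by (simp only: summable_complex_of_real)
    have "B x x = of_real (\<Sum>m. (1 / 2) ^ m * Re (F m x x))"
      unfolding B_def eq by (rule suminf_of_real[OF sRe, symmetric])
    then show "Re (B x x) = (\<Sum>m. (1 / 2) ^ m * Re (F m x x))" "Im (B x x) = 0"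
      by simp_all
    show "0 \<le> Re (F m x x)"
      using F(2) by (simp add: positive_form_def)
  qed
  show "positive_form B"
    unfolding positive_form_def complex_is_Real_iff Re_B by (auto intro!: suminf_nonneg sRe pos mult_nonneg_nonneg)
  show "(1 / 2) ^ m * Re (F m x x) \<le> Re (B x x)" for m x
    using sum_le_suminf[OF sRe[of x], of "{m}"] by (simp add: Re_B pos)
  show "jcb_at_most 2 (bilinear_of B)"
  proof (rule jcb_at_most_limit)
    fix N
    have "jcb_at_most (\<Sum>m<N. cmod ((1 / 2) ^ m) * 1) (\<lambda>a b. \<Sum>m<N. (1 / 2) ^ m * bilinear_of (F m) a b)"
      by (intro jcb_at_most_sum jcb_at_most_scale F)
    moreover have "(\<Sum>m<N. cmod ((1 / 2) ^ m) * 1) \<le> 2"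
    proof -
      have "(\<Sum>m<N. (1 / 2 :: real) ^ m) \<le> (\<Sum>m. (1 / 2) ^ m)"
        by (intro sum_le_suminf summable_geometric) auto
      then show ?thesis
        by (simp add: norm_power norm_divide suminf_geometric)
    qed
    ultimately show "jcb_at_most 2 (\<lambda>a b. \<Sum>m<N. (1 / 2) ^ m * bilinear_of (F m) a b)"
      by (rule jcb_at_most_mono)
  next
    show "(\<lambda>N. \<Sum>m<N. (1 / 2) ^ m * bilinear_of (F m) a b) \<longlonglongrightarrow> bilinear_of B a b" for a b
      unfolding bilinear_of_def B_def by (rule summable_LIMSEQ[OF sm])
  qed
qed

theorem theorem1:
  assumes infinite_dimensional:
    "\<not> (\<exists>E :: 'h::complex_hilbert_space set. finite E \<and> complex_vector.span E = UNIV)"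
  shows
    "(\<exists>B :: 'h bop \<Rightarrow> 'h bop \<Rightarrow> complex.
        sesquilinear_form B \<and> positive_form B \<and> jcb_form (bilinear_of B) \<and>
        \<not> (\<exists>B'. sesquilinear_form B' \<and> integral_form (bilinear_of B') \<and> majorized_by B B')) \<and>
     (\<exists>C::real. C > 0 \<and> (\<forall>n::nat. n \<ge> 1 \<longrightarrow>
        (\<exists>B :: 'h bop \<Rightarrow> 'h bop \<Rightarrow> complex.
           sesquilinear_form B \<and> positive_form B \<and> integral_form (bilinear_of B) \<and>
           form_rank B n \<and>
           (\<forall>B'. sesquilinear_form B' \<and> integral_form (bilinear_of B') \<and> majorized_by B B' \<longrightarrow>
              (1 + ln (real n)) * jcb_norm (bilinear_of B) \<le> C * integral_norm (bilinear_of B')))))"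
proof (rule conjI)
  \<comment> \<open>With \<open>L = 4 ^ m\<close> and \<open>n = 4 ^ L\<close> the quotient of the
    two bounds grows like \<open>4 ^ m\<close>, faster than the weight \<open>(1 / 2) ^ m\<close>
    decays.\<close>
  have "\<exists>e :: nat \<times> nat \<Rightarrow> 'h. orthonormal e ({..4 ^ m} \<times> {..4 ^ 4 ^ m})" for m :: nat
    by (rule orthonormal_family_exists[OF infinite_dimensional]) simp
  then obtain E :: "nat \<Rightarrow> nat \<times> nat \<Rightarrow> 'h" where E: "orthonormal (E m) ({..4 ^ m} \<times> {..4 ^ 4 ^ m})" for m
    by metis
  have lev: "levels (E m) (4 ^ m) (4 ^ 4 ^ m)" for m
    by (simp add: levels_def E)
  define N where "N m = real (4 ^ 4 ^ m)" for m :: nat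
  \<comment> \<open>The jcb bound of the \<open>m\<close>-th form, by which that form is
    normalized.\<close>
  define D where "D m = 4 * sqrt (2 * N m) * Suc (4 ^ m)" for m :: nat
  define G where "G m = levels.form (E m) (4 ^ m) (4 ^ 4 ^ m)" for m
  define F where "F m = (\<lambda>x y. complex_of_real (1 / D m) * G m x y)" for m
  have N: "0 < N m" for m
    by (simp add: N_def)
  have Suc_pos: "0 < real (Suc (4 ^ m))" for m :: nat
    by (simp only: of_nat_0_less_iff zero_less_Suc)
  with N have D: "0 < D m" for m
    unfolding D_def by (intro mult_pos_pos) simp_all
  have G: "sesquilinear_form (G m)" "positive_form (G m)" "jcb_at_most (D m) (bilinear_of (G m))" for m
    unfolding G_def D_def N_def
    using levels.sesquilinear_form[OF lev] levels.positive_form[OF lev] levels.jcb_at_most_form[OF lev, of m]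
    by simp_all
  have Re_F: "Re (F m x x) = Re (G m x x) / D m" for m x
    by (simp add: F_def)
  have "sesquilinear_form (F m)" for m
    using G(1)[of m] by (simp add: sesquilinear_form_iff F_def add_divide_distrib)
  moreover have "positive_form (F m)" for m
    using G(2)[of m] D[of m] by (auto simp: positive_form_def F_def complex_is_Real_iff)
  moreover have "jcb_at_most 1 (bilinear_of (F m))" for m
    using jcb_at_most_scale[OF G(3)[of m], of "complex_of_real (1 / D m)"] D[of m]
    by (simp add: bilinear_of_def F_def norm_divide)
  ultimately obtain B where B: "sesquilinear_form B" "positive_form B" "jcb_at_most 2 (bilinear_of B)"
    "\<And>m x. (1 / 2) ^ m * Re (F m x x) \<le> Re (B x x)"
    using jcb_series by blast
  have "jcb_form (bilinear_of B)"
    using B(1) jcb_bounds_member[OF _ B(3)] by (auto simp: jcb_form_def bilinear_form_bilinear_of)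
  moreover have False if B': "sesquilinear_form B'" "integral_form (bilinear_of B')" "majorized_by B B'" for B'
  proof -
    let ?K = "integral_norm (bilinear_of B')"
    \<comment> \<open>The 8 is the jcb constant 4 times the 2 from the square of
      \<open>sqrt (2 * N m)\<close>; \<open>2 ^ m\<close> is the gain \<open>4 ^ m\<close> times the
      weight.\<close>
    have "2 ^ m \<le> 8 * ?K" for m :: nat
    proof -
      let ?l = "real (Suc (4 ^ m))"
      have "(1 / 2) ^ m / D m * Re (G m x x) \<le> cmod (B' x x)" for x
        using B(4)[of m x] B'(3)[unfolded majorized_by_def, rule_format, of x] by (simp add: Re_F)
      then have "(1 / 2) ^ m / D m * (N m * ?l\<^sup>2) \<le> ?K * sqrt (2 * N m)"
        using levels.majorant_bound[OF lev B'(1,2), of "(1 / 2) ^ m / D m" m] unfolding G_def N_def by simp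
      then have "(1 / 2) ^ m / D m * (N m * ?l\<^sup>2) * D m \<le> ?K * sqrt (2 * N m) * D m"
        using D[of m] by (intro mult_right_mono) simp_all
      moreover have "(1 / 2) ^ m / D m * (N m * ?l\<^sup>2) * D m = (1 / 2) ^ m * ?l * (N m * ?l)"
        using D[of m] by (simp add: power2_eq_square)
      moreover have "?K * sqrt (2 * N m) * D m = 8 * ?K * (N m * ?l)"
        using N[of m] real_sqrt_mult_self[of "2 * N m"] by (simp add: D_def)
      ultimately have "(1 / 2) ^ m * ?l * (N m * ?l) \<le> 8 * ?K * (N m * ?l)"
        by simp
      then have "(1 / 2) ^ m * ?l \<le> 8 * ?K"
        by (rule mult_right_le_imp_le) (intro mult_pos_pos N Suc_pos)
      moreover have "(1 / 2) ^ m * (4::real) ^ m = 2 ^ m"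
        by (simp flip: power_mult_distrib)
      moreover have "(1 / 2) ^ m * (4::real) ^ m \<le> (1 / 2) ^ m * ?l"
        by (rule mult_left_mono) simp_all
      ultimately show ?thesis
        by linarith
    qed
    moreover obtain m where "8 * ?K < 2 ^ m"
      using real_arch_pow[of 2 "8 * ?K"] by auto
    ultimately show False
      by (metis not_le)
  qed
  ultimately show "\<exists>B :: 'h bop \<Rightarrow> 'h bop \<Rightarrow> complex.
      sesquilinear_form B \<and> positive_form B \<and> jcb_form (bilinear_of B) \<and>
      \<not> (\<exists>B'. sesquilinear_form B' \<and> integral_form (bilinear_of B') \<and> majorized_by B B')"
    using B by blast
next
  show "\<exists>C::real. C > 0 \<and> (\<forall>n::nat. n \<ge> 1 \<longrightarrow>
        (\<exists>B :: 'h bop \<Rightarrow> 'h bop \<Rightarrow> complex.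
           sesquilinear_form B \<and> positive_form B \<and> integral_form (bilinear_of B) \<and>
           form_rank B n \<and>
           (\<forall>B'. sesquilinear_form B' \<and> integral_form (bilinear_of B') \<and> majorized_by B B' \<longrightarrow>
              (1 + ln (real n)) * jcb_norm (bilinear_of B) \<le> C * integral_norm (bilinear_of B'))))"
  \<comment> \<open>24 is the product of 3 from \<open>1 + ln n \<le> 3 * Suc L\<close>, 4 from the
    jcb bound and 2 from the square of \<open>sqrt (2 * n)\<close>.\<close>
  proof (rule exI[of _ 24], intro conjI allI impI)
    fix n :: nat assume n: "1 \<le> n"
    \<comment> \<open>As many levels as \<open>n\<close> permits; the strict upper bound ties
      \<open>ln n\<close> to \<open>L\<close>.\<close>
    then obtain L where L: "4 ^ L \<le> n" "n < 4 ^ (L + 1)"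
      using ex_power_ivl1[of 4 n] by auto
    obtain e :: "nat \<times> nat \<Rightarrow> 'h" where "orthonormal e ({..L} \<times> {..n})"
      using orthonormal_family_exists[OF infinite_dimensional, of "{..L} \<times> {..n}"] by auto
    then interpret levels e L n
      using L by unfold_locales
    have "real n \<le> real (4 ^ Suc L)"
      using L(2) by (intro of_nat_mono) simp
    then have "ln (real n) \<le> ln (4 ^ Suc L)"
      using n by (subst ln_le_cancel_iff) simp_all
    also have "\<dots> = Suc L * (2 * ln 2)"
      using ln_realpow[of 2 2] by (simp add: ln_realpow[of 4 "Suc L"] del: power_Suc)
    also have "\<dots> \<le> real (Suc L) * 2"
      using ln_2_less_1 by (intro mult_left_mono) simp_all
    finally have ln: "1 + ln (real n) \<le> 3 * Suc L"
      by simp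
    have jcb: "jcb_norm (bilinear_of form) \<le> 4 * sqrt (2 * n) * Suc L"
      unfolding jcb_norm_def using jcb_bounds_member[OF _ jcb_at_most_form]
      by (intro cInf_lower bdd_belowI[of _ 0]) (auto simp: jcb_bounds_def)
    have "(1 + ln (real n)) * jcb_norm (bilinear_of form) \<le> 24 * integral_norm (bilinear_of B')"
      if B': "sesquilinear_form B'" "integral_form (bilinear_of B')" "majorized_by form B'" for B'
    proof -
      let ?K = "integral_norm (bilinear_of B')" and ?l = "real (Suc L)" and ?s = "sqrt (2 * n)"
      have s: "?s * ?s = 2 * n" "0 < ?s"
        using n by simp_all
      have K: "n * ?l\<^sup>2 \<le> ?K * ?s"
        using majorant_bound[OF B'(1,2), of 1] B'(3) by (simp add: majorized_by_def)
      have "(?s * ?l\<^sup>2) * ?s = (?s * ?s) * ?l\<^sup>2"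
        by (simp only: mult_ac)
      also have "\<dots> = 2 * (n * ?l\<^sup>2)"
        unfolding s(1) by simp
      also have "\<dots> \<le> (2 * ?K) * ?s"
        using K by simp
      finally have "?s * ?l\<^sup>2 \<le> 2 * ?K"
        using s(2) by (rule mult_right_le_imp_le)
      have "(1 + ln (real n)) * jcb_norm (bilinear_of form) \<le> (1 + ln (real n)) * (4 * ?s * ?l)"
        using n by (intro mult_left_mono jcb) simp
      also have "\<dots> \<le> 3 * ?l * (4 * ?s * ?l)"
        using ln by (intro mult_right_mono) simp_all
      also have "\<dots> = 12 * (?s * ?l\<^sup>2)"
        by (simp add: power2_eq_square algebra_simps)
      also have "\<dots> \<le> 24 * ?K"
        using \<open>?s * ?l\<^sup>2 \<le> 2 * ?K\<close> by simp
      finally show ?thesis .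
    qed
    then show "\<exists>B :: 'h bop \<Rightarrow> 'h bop \<Rightarrow> complex.
           sesquilinear_form B \<and> positive_form B \<and> integral_form (bilinear_of B) \<and>
           form_rank B n \<and>
           (\<forall>B'. sesquilinear_form B' \<and> integral_form (bilinear_of B') \<and> majorized_by B B' \<longrightarrow>
              (1 + ln (real n)) * jcb_norm (bilinear_of B) \<le> 24 * integral_norm (bilinear_of B'))"
      using sesquilinear_form positive_form integral_form form_rank by blast
  qed simp
qed

end
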